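(* Let $\boldsymbol{X}\sim N_n(\boldsymbol{\theta},\boldsymbol{\Sigma})$, where $\boldsymbol{\theta}\in\mathbb{R}^n$ is unknown but fixed and $\boldsymbol{\Sigma}$ is an arbitrary but known $n\times n$ positive definite covariance matrix. Consider the two-sided multiple testing problem of testing $H_{0i}:\theta_i=0$ against $H_{Ai}:\theta_i\neq 0$ simultaneously for $i=1,\dots,n$. Let $(h_{tj}^{(i_1,\dots,i_{t-1})})$ be any family of strictly increasing functions $h_{tj}^{(i_1,\dots,i_{t-1})}:[0,\infty)\to\mathbb{R}$, indexed by $t,j\in\{1,\dots,n\}$ and distinct $i_1,\dots,i_{t-1}\in\{1,\dots,n\}\setminus\{j\}$, and let $C^G_1\ge C^G_2\ge\cdots\ge C^G_n>0$ be any constants. Then the monotone residual-based step-down multiple testing procedure $\Phi=(\phi_1,\dots,\phi_n)$ based on the statistics $S_{tj}^{(i_1,\dots,i_{t-1})}=h_{tj}^{(i_1,\dots,i_{t-1})}(|U_{tj}^{(i_1,\dots,i_{t-1})}|)$ and the constants $C^G_1,\dots,C^G_n$ is admissible with respect to the vector loss function $L(\Phi(\boldsymbol{X}),\boldsymbol{\theta})=(L_1(\phi_1(\boldsymbol{X}),\boldsymbol{\theta}),\dots,L_n(\phi_n(\boldsymbol{X}),\boldsymbol{\theta}))$.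
   Context: Residual statistics. Write $\boldsymbol{\Sigma}=((\sigma_{ij}))$. For distinct indices $i_1,\dots,i_m$: $\boldsymbol{x}^{(i_1,\dots,i_m)}$ is the vector obtained from $\boldsymbol{x}\in\mathbb{R}^n$ by deleting the coordinates $i_1,\dots,i_m$; $\boldsymbol{\Sigma}_{(i_1,\dots,i_m)}$ is the submatrix of $\boldsymbol{\Sigma}$ obtained by deleting the rows and columns $i_1,\dots,i_m$; and, for $j\notin\{i_1,\dots,i_m\}$, $\boldsymbol{\sigma}_{(j)}^{(i_1,\dots,i_m)}$ is the vector obtained from the $j$-th column of $\boldsymbol{\Sigma}$ by deleting the entries $i_1,\dots,i_m$ and $j$. Put $$\sigma_{j\cdot(i_1,\dots,i_m)}=\sigma_{jj}-\big(\boldsymbol{\sigma}_{(j)}^{(i_1,\dots,i_m)}\big)^T\boldsymbol{\Sigma}_{(i_1,\dots,i_m,j)}^{-1}\boldsymbol{\sigma}_{(j)}^{(i_1,\dots,i_m)}.$$ For $t,j\in\{1,\dots,n\}$ and distinct $i_1,\dots,i_{t-1}\in\{1,\dots,n\}\setminus\{j\}$ define $$U_{tj}^{(i_1,\dots,i_{t-1})}(\boldsymbol{x})=\frac{x_j-\big(\boldsymbol{\sigma}_{(j)}^{(i_1,\dots,i_{t-1})}\big)^T\boldsymbol{\Sigma}_{(i_1,\dots,i_{t-1},j)}^{-1}\boldsymbol{x}^{(i_1,\dots,i_{t-1},j)}}{\sigma_{j\cdot(i_1,\dots,i_{t-1})}^{1/2}}$$ (the correction terms are $0$ when no coordinates remain;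 the superscript list is empty when $t=1$). Generalized statistics and indices. $S_{tj}^{(i_1,\dots,i_{t-1})}(\boldsymbol{x})=h_{tj}^{(i_1,\dots,i_{t-1})}\big(|U_{tj}^{(i_1,\dots,i_{t-1})}(\boldsymbol{x})|\big)$. Recursively for $t=1,\dots,n$, $$j_t(\boldsymbol{x})=\operatorname{argmax}_{j\in\{1,\dots,n\}\setminus\{j_1(\boldsymbol{x}),\dots,j_{t-1}(\boldsymbol{x})\}} S_{tj}^{(j_1(\boldsymbol{x}),\dots,j_{t-1}(\boldsymbol{x}))}(\boldsymbol{x}).$$ Ties occur with probability zero and are broken by an arbitrary measurable convention. Procedure. At stage $t=1,2,\dots,n$ (in this order), reject $H_{0j_t(\boldsymbol{x})}$ and pass to stage $t+1$ if $S_{tj_t(\boldsymbol{x})}^{(j_1(\boldsymbol{x}),\dots,j_{t-1}(\boldsymbol{x}))}(\boldsymbol{x})>C^G_t$; otherwise stop and accept all remaining null hypotheses. The procedure continues until an acceptance occurs or all null hypotheses have been rejected. $\phi_j(\boldsymbol{x})=1$ if $H_{0j}$ is rejected when $\boldsymbol{X}=\boldsymbol{x}$ is observed, and $\phi_j(\boldsymbol{x})=0$ otherwise. Loss, risk, admissibility. A multiple testing procedure is a vector $\Phi=(\phi_1,\dots,\phi_n)$ of (measurable) test functions $\phi_j:\mathbb{R}^n\to[0,1]$, where $\phi_j(\boldsymbol{x})$ is the probability of rejecting $H_{0j}$ when $\boldsymbol{x}$ is observed. The individual losses are $L_j(\phi_j(\boldsymbol{X}),\boldsymbol{\theta})=I\{\theta_j=0\}\phi_j(\boldsymbol{X})+I\{\theta_j\ne0\}(1-\phi_j(\boldsymbol{X}))$,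 with risks $R_j(\phi_j,\boldsymbol{\theta})=E_{\boldsymbol{\theta}}[L_j(\phi_j(\boldsymbol{X}),\boldsymbol{\theta})]$. $\Phi$ is inadmissible with respect to the vector loss if there is another multiple testing procedure $\Phi^*=(\phi_1^*,\dots,\phi_n^* )$ with $R_j(\phi^*_j,\boldsymbol{\theta})\le R_j(\phi_j,\boldsymbol{\theta})$ for all $j=1,\dots,n$ and all $\boldsymbol{\theta}\in\mathbb{R}^n$, with strict inequality for at least one $j$ and some $\boldsymbol{\theta}\in\mathbb{R}^n$. $\Phi$ is admissible if it is not inadmissible. *)

theory Defs
  imports "HOL-Probability.Probability"
begin

section \<open>Multivariate normal distributions\<close>

definition positive_definite :: "real^'n^'n \<Rightarrow> bool" where
  "positive_definite A \<longleftrightarrow> transpose A = A \<and> (\<forall>x. x \<noteq> 0 \<longrightarrow> 0 < x \<bullet> (A *v x))"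

definition mvn_density :: "real^'n \<Rightarrow> real^'n^'n \<Rightarrow> real^'n \<Rightarrow> real" where
  "mvn_density \<theta> A x =
     exp (- ((x - \<theta>) \<bullet> (matrix_inv A *v (x - \<theta>))) / 2) / sqrt ((2 * pi) ^ CARD('n) * det A)"

definition mvn :: "real^'n \<Rightarrow> real^'n^'n \<Rightarrow> (real^'n) measure" where
  "mvn \<theta> A = density lborel (\<lambda>x. ennreal (mvn_density \<theta> A x))"


section \<open>Deleting coordinates\<close>

text \<open>The dimension is a type, so the vector (matrix) obtained by deleting the coordinates
  (rows and columns) in a set \<open>L\<close> is represented by the vector (matrix) of the original
  dimension whose entries at deleted positions are \<open>0\<close>.  Sums, inner products and matrix
  products of such objects are those of the deleted ones; in particular they are \<open>0\<close> if no
  coordinates remain.\<close>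

definition del_vec :: "'n set \<Rightarrow> real^'n \<Rightarrow> real^'n" where
  "del_vec L x = (\<chi> i. if i \<in> L then 0 else x $ i)"

definition del_mat :: "'n set \<Rightarrow> real^'n^'n \<Rightarrow> real^'n^'n" where
  "del_mat L A = (\<chi> i k. if i \<in> L \<or> k \<in> L then 0 else A $ i $ k)"

text \<open>The inverse of the submatrix: \<^term>\<open>del_mat L (mat 1)\<close> is the identity matrix of the
  reduced size, and \<^prop>\<open>del_mat L B = B\<close> says that \<open>B\<close> has that size.\<close>

definition del_inv :: "'n set \<Rightarrow> real^'n^'n \<Rightarrow> real^'n^'n" where
  "del_inv L A = (THE B. del_mat L B = B \<and>
     del_mat L A ** B = del_mat L (mat 1) \<and> B ** del_mat L A = del_mat L (mat 1))"

lemma del_mat_mult_del_mat_one: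
  fixes B :: "real^'n^'n"
  assumes "del_mat L B = B"
  shows "B ** del_mat L (mat 1) = B" "del_mat L (mat 1) ** B = B"
proof -
  have z: "B $ i $ k = 0" if "i \<in> L \<or> k \<in> L" for i k
    using that by (subst assms[symmetric]) (auto simp: del_mat_def)
  have "(\<Sum>k\<in>UNIV. B $ i $ k * del_mat L (mat 1) $ k $ j) = B $ i $ j" for i j
  proof -
    have "(\<Sum>k\<in>UNIV. B $ i $ k * del_mat L (mat 1) $ k $ j) =
          (\<Sum>k\<in>UNIV. if k = j then B $ i $ k else 0)"
      by (rule sum.cong) (auto simp: del_mat_def mat_def z)
    thus ?thesis by simp
  qed
  moreover have "(\<Sum>k\<in>UNIV. del_mat L (mat 1) $ i $ k * B $ k $ j) = B $ i $ j" for i j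
  proof -
    have "(\<Sum>k\<in>UNIV. del_mat L (mat 1) $ i $ k * B $ k $ j) =
          (\<Sum>k\<in>UNIV. if k = i then B $ k $ j else 0)"
      by (rule sum.cong) (auto simp: del_mat_def mat_def z)
    thus ?thesis by simp
  qed
  ultimately show "B ** del_mat L (mat 1) = B" "del_mat L (mat 1) ** B = B"
    by (simp_all add: matrix_matrix_mult_def vec_eq_iff)
qed

lemma del_mat_mult_padded:
  fixes M N A :: "real^'n^'n"
  assumes M: "M = (\<chi> i k. if i \<in> L \<or> k \<in> L then (if i = k then 1 else 0) else A $ i $ k)"
  shows "del_mat L A ** del_mat L N = del_mat L (M ** N)"
    "del_mat L N ** del_mat L A = del_mat L (N ** M)"
proof -
  have "(\<Sum>k\<in>UNIV. del_mat L A $ i $ k * del_mat L N $ k $ j) = del_mat L (M ** N) $ i $ j" for i j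
    by (auto simp: del_mat_def M matrix_matrix_mult_def intro!: sum.cong sum.neutral)
  moreover have "(\<Sum>k\<in>UNIV. del_mat L N $ i $ k * del_mat L A $ k $ j) =
      del_mat L (N ** M) $ i $ j" for i j
    by (auto simp: del_mat_def M matrix_matrix_mult_def intro!: sum.cong sum.neutral)
  ultimately show "del_mat L A ** del_mat L N = del_mat L (M ** N)"
    "del_mat L N ** del_mat L A = del_mat L (N ** M)"
    by (simp_all add: matrix_matrix_mult_def vec_eq_iff)
qed

lemma padded_ker:
  fixes M A :: "real^'n^'n"
  assumes M: "M = (\<chi> i k. if i \<in> L \<or> k \<in> L then (if i = k then 1 else 0) else A $ i $ k)"
    and A: "positive_definite A" and x: "M *v x = 0"
  shows "x = 0"
proof -
  have xL: "x $ i = 0" if "i \<in> L" for i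
  proof -
    have "(M *v x) $ i = (\<Sum>k\<in>UNIV. if k = i then x $ k else 0)"
      unfolding matrix_vector_mult_def vec_lambda_beta using that
      by (intro sum.cong) (auto simp: M)
    thus ?thesis using x by simp
  qed
  have "(A *v x) $ i = 0" if "i \<notin> L" for i
  proof -
    have "(A *v x) $ i = (M *v x) $ i"
      unfolding matrix_vector_mult_def using that by (auto simp: M xL intro!: sum.cong)
    thus ?thesis using x by simp
  qed
  hence "x $ i * (A *v x) $ i = 0" for i
    using xL by (cases "i \<in> L") auto
  hence "x \<bullet> (A *v x) = 0"
    unfolding inner_vec_def inner_real_def by (intro sum.neutral ballI)
  thus ?thesis using A unfolding positive_definite_def by force
qed

lemma del_inv_well_defined:
  fixes A :: "real^'n^'n"
  assumes "positive_definite A"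
  shows "\<exists>!B. del_mat L B = B \<and>
     del_mat L A ** B = del_mat L (mat 1) \<and> B ** del_mat L A = del_mat L (mat 1)"
proof -
  define M :: "real^'n^'n"
    where "M = (\<chi> i k. if i \<in> L \<or> k \<in> L then (if i = k then 1 else 0) else A $ i $ k)"
  obtain N where N: "N ** M = mat 1"
    using padded_ker[OF M_def assms] matrix_left_invertible_ker[of M] by blast
  hence N': "M ** N = mat 1" by (simp add: matrix_left_right_inverse)
  show ?thesis
  proof (rule ex1I[of _ "del_mat L N"], intro conjI)
    show "del_mat L (del_mat L N) = del_mat L N"
      by (auto simp: del_mat_def vec_eq_iff)
    show NR: "del_mat L A ** del_mat L N = del_mat L (mat 1)"
      using del_mat_mult_padded(1)[OF M_def] N' by simp
    show "del_mat L N ** del_mat L A = del_mat L (mat 1)"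
      using del_mat_mult_padded(2)[OF M_def] N by simp
    fix B assume B: "del_mat L B = B \<and>
      del_mat L A ** B = del_mat L (mat 1) \<and> B ** del_mat L A = del_mat L (mat 1)"
    have "B = B ** (del_mat L A ** del_mat L N)"
      using B NR del_mat_mult_del_mat_one(1)[of L B] by simp
    also have "\<dots> = del_mat L (mat 1) ** del_mat L N"
      using B by (simp add: matrix_mul_assoc)
    also have "\<dots> = del_mat L N"
      by (rule del_mat_mult_del_mat_one(2)) (auto simp: del_mat_def vec_eq_iff)
    finally show "B = del_mat L N" .
  qed
qed


section \<open>Residual statistics\<close>

text \<open>In the following the list \<open>ks\<close> is the tuple \<open>(i\<^sub>1, \<dots>, i\<^sub>t\<^sub>-\<^sub>1)\<close>.\<close>

definition res_col :: "real^'n^'n \<Rightarrow> 'n list \<Rightarrow> 'n \<Rightarrow> real^'n" where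
  "res_col A ks j = del_vec (insert j (set ks)) (column j A)"

definition res_var :: "real^'n^'n \<Rightarrow> 'n list \<Rightarrow> 'n \<Rightarrow> real" where
  "res_var A ks j =
     A $ j $ j - res_col A ks j \<bullet> (del_inv (insert j (set ks)) A *v res_col A ks j)"

definition res_stat :: "real^'n^'n \<Rightarrow> 'n list \<Rightarrow> 'n \<Rightarrow> real^'n \<Rightarrow> real" where
  "res_stat A ks j x =
     (x $ j - res_col A ks j \<bullet>
        (del_inv (insert j (set ks)) A *v del_vec (insert j (set ks)) x)) / sqrt (res_var A ks j)"

definition gen_stat ::
    "real^'n^'n \<Rightarrow> (nat \<Rightarrow> 'n \<Rightarrow> 'n list \<Rightarrow> real \<Rightarrow> real) \<Rightarrow> nat \<Rightarrow> 'n \<Rightarrow> 'n list \<Rightarrow> real^'n \<Rightarrow> real" where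
  "gen_stat A h t j ks x = h t j ks \<bar>res_stat A ks j x\<bar>"


section \<open>The residual-based step-down procedure\<close>

definition earlier :: "(nat \<Rightarrow> real^'n \<Rightarrow> 'n) \<Rightarrow> nat \<Rightarrow> real^'n \<Rightarrow> 'n list" where
  "earlier J t x = map (\<lambda>s. J s x) [1..<t]"

text \<open>\<open>J t x\<close> is the index \<open>j\<^sub>t(x)\<close>.  The maximiser need not be unique; every measurable choice
  among the maximisers is allowed.\<close>

definition argmax_selection ::
    "real^'n^'n \<Rightarrow> (nat \<Rightarrow> 'n \<Rightarrow> 'n list \<Rightarrow> real \<Rightarrow> real) \<Rightarrow> (nat \<Rightarrow> real^'n \<Rightarrow> 'n) \<Rightarrow> bool" where
  "argmax_selection A h J \<longleftrightarrow> (\<forall>t\<in>{1..CARD('n)}.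
     J t \<in> measurable borel (count_space UNIV) \<and>
     (\<forall>x. is_arg_max (\<lambda>j. gen_stat A h t j (earlier J t x) x)
            (\<lambda>j. j \<notin> set (earlier J t x)) (J t x)))"

definition passes ::
    "real^'n^'n \<Rightarrow> (nat \<Rightarrow> 'n \<Rightarrow> 'n list \<Rightarrow> real \<Rightarrow> real) \<Rightarrow> (nat \<Rightarrow> real) \<Rightarrow>
     (nat \<Rightarrow> real^'n \<Rightarrow> 'n) \<Rightarrow> nat \<Rightarrow> real^'n \<Rightarrow> bool" where
  "passes A h C J t x \<longleftrightarrow> gen_stat A h t (J t x) (earlier J t x) x > C t"

definition step_down ::
    "real^'n^'n \<Rightarrow> (nat \<Rightarrow> 'n \<Rightarrow> 'n list \<Rightarrow> real \<Rightarrow> real) \<Rightarrow> (nat \<Rightarrow> real) \<Rightarrow>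
     (nat \<Rightarrow> real^'n \<Rightarrow> 'n) \<Rightarrow> 'n \<Rightarrow> real^'n \<Rightarrow> real" where
  "step_down A h C J j x =
     (if \<exists>t\<in>{1..CARD('n)}. (\<forall>s\<in>{1..t}. passes A h C J s x) \<and> J t x = j then 1 else 0)"


section \<open>Loss, risk and admissibility\<close>

definition multiple_test :: "('n \<Rightarrow> real^'n \<Rightarrow> real) \<Rightarrow> bool" where
  "multiple_test \<Phi> \<longleftrightarrow> (\<forall>j. \<Phi> j \<in> borel_measurable borel \<and> (\<forall>x. 0 \<le> \<Phi> j x \<and> \<Phi> j x \<le> 1))"

definition loss :: "'n \<Rightarrow> real \<Rightarrow> real^'n \<Rightarrow> real" where
  "loss j p \<theta> = of_bool (\<theta> $ j = 0) * p + of_bool (\<theta> $ j \<noteq> 0) * (1 - p)"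

definition risk :: "real^'n^'n \<Rightarrow> 'n \<Rightarrow> (real^'n \<Rightarrow> real) \<Rightarrow> real^'n \<Rightarrow> real" where
  "risk A j \<phi> \<theta> = (\<integral>x. loss j (\<phi> x) \<theta> \<partial>mvn \<theta> A)"

definition inadmissible :: "real^'n^'n \<Rightarrow> ('n \<Rightarrow> real^'n \<Rightarrow> real) \<Rightarrow> bool" where
  "inadmissible A \<Phi> \<longleftrightarrow> (\<exists>\<Phi>'. multiple_test \<Phi>' \<and>
     (\<forall>j \<theta>. risk A j (\<Phi>' j) \<theta> \<le> risk A j (\<Phi> j) \<theta>) \<and>
     (\<exists>j \<theta>. risk A j (\<Phi>' j) \<theta> < risk A j (\<Phi> j) \<theta>))"

text \<open>Measurability of the tests is part of being a multiple testing procedure, and without it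
  the risk integral would be meaningless; hence it is included here.\<close>

definition admissible :: "real^'n^'n \<Rightarrow> ('n \<Rightarrow> real^'n \<Rightarrow> real) \<Rightarrow> bool" where
  "admissible A \<Phi> \<longleftrightarrow> multiple_test \<Phi> \<and> \<not> inadmissible A \<Phi>"

end

theory Submission
  imports Defs
begin

text \<open>Since risks are compared coordinatewise, it suffices that a test \<open>\<phi>'\<close> which is at least as good as
  \<open>\<phi> = \<phi>\<^sub>j\<close> for \<open>\<theta>\<^sub>j = 0\<close> versus \<open>\<theta>\<^sub>j \<noteq> 0\<close> agrees with it almost everywhere.  Translating \<open>x\<close> along the
  \<open>j\<close>-th column \<open>g\<close> of \<open>\<Sigma>\<close> leaves every residual statistic of the other indices unchanged as long as \<open>j\<close>
  is not selected, and moves that of \<open>j\<close> monotonically.  Hence, off a null set of ties, \<open>\<phi>\<close> accepts on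
  an interval of each line with direction \<open>g\<close>.

  The rest is the argument of Matthes and Truax for exponential families.  With \<open>\<eta> = \<Sigma>\<^sup>-\<^sup>1\<theta>\<close> the hypothesis
  is \<open>\<eta> \<bullet> g = 0\<close>, and \<open>D \<eta> = \<integral> (\<phi>' - \<phi>) w exp (\<eta> \<bullet> x)\<close> is nonnegative off this hyperplane and nonpositive
  on it.  Thus \<open>D\<close> and its derivative across the hyperplane vanish on it, while the second derivative
  is nonnegative there.  By uniqueness of Laplace transforms the integrals of \<open>(\<phi>' - \<phi>) w\<close>
  against \<open>1\<close> and \<open>r\<close> vanish on almost every line.  Subtracting a suitable affine function turns
  \<open>r\<^sup>2\<close> into a quadratic that is nonpositive on the acceptance interval and nonnegative off it, so the integral
  against \<open>r\<^sup>2\<close> is nonpositive on almost every line; its total is nonnegative, which forces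
  \<open>\<phi>' = \<phi>\<close> almost everywhere.  (Unbounded or empty intervals are handled by affine functions alone.)\<close>


section \<open>Uniqueness of Laplace transforms\<close>

lemma sum_power_over_fact_le_exp:
  fixes t :: real
  assumes "0 \<le> t"
  shows "(\<Sum>k<n. t ^ k / fact k) \<le> exp t"
proof -
  have "(\<Sum>k<n. t ^ k /\<^sub>R fact k) \<le> exp t"
    unfolding exp_def using assms by (intro sum_le_suminf summable_exp_generic) auto
  thus ?thesis by (simp add: divide_inverse_commute)
qed

text \<open>The bound \<open>exp (T * \<bar>u x\<bar>)\<close> \<le>
  \<open>exp (T * u x) + exp ((-T) * u x)\<close> reduces two-sided exponential growth to the
  one-sided hypotheses. This supplies the dominating functions for the moment expansion.\<close>

lemma integrable_exp_abs:
  fixes f u :: "'a \<Rightarrow> real"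
  assumes [measurable]: "f \<in> borel_measurable M" "u \<in> borel_measurable M"
    and int: "\<And>t. integrable M (\<lambda>x. f x * exp (t * u x))"
  shows "integrable M (\<lambda>x. \<bar>f x\<bar> * exp (T * \<bar>u x\<bar>))"
proof (rule Bochner_Integration.integrable_bound)
  show "integrable M (\<lambda>x. \<bar>f x * exp (T * u x)\<bar> + \<bar>f x * exp ((-T) * u x)\<bar>)"
    by (intro Bochner_Integration.integrable_add integrable_abs int)
  show "AE x in M. norm (\<bar>f x\<bar> * exp (T * \<bar>u x\<bar>)) \<le>
      norm (\<bar>f x * exp (T * u x)\<bar> + \<bar>f x * exp ((-T) * u x)\<bar>)"
    proof (intro AE_I2)
    fix x
    have "\<bar>f x\<bar> * exp (T * \<bar>u x\<bar>) \<le> \<bar>f x\<bar> * (exp (T * u x) + exp ((-T) * u x))"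
      by (intro mult_left_mono) (auto simp: abs_if)
    thus "norm (\<bar>f x\<bar> * exp (T * \<bar>u x\<bar>)) \<le>
      norm (\<bar>f x * exp (T * u x)\<bar> + \<bar>f x * exp ((-T) * u x)\<bar>)"
      by (simp add: abs_mult distrib_left)
  qed
qed measurable

text \<open>The exponential series may be integrated term by term because its absolute partial sums
  are dominated by \<open>\<bar>f x\<bar> * exp (norm z * \<bar>u x\<bar>)\<close>. The type of
  \<open>z\<close> is left general: real \<open>z\<close> gives moment generating functions,
  imaginary \<open>z\<close> gives characteristic functions.\<close>

lemma
  fixes f u :: "'a \<Rightarrow> real" and z :: "'b::{real_normed_field,banach,second_countable_topology}"
  assumes [measurable]: "f \<in> borel_measurable M" "u \<in> borel_measurable M"
    and int: "\<And>t. integrable M (\<lambda>x. f x * exp (t * u x))"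
  shows integrable_moment: "integrable M (\<lambda>x. f x * u x ^ k)"
    and exp_integral_sums:
      "(\<lambda>k. ((\<integral>x. f x * u x ^ k \<partial>M) / fact k) *\<^sub>R z ^ k) sums
         (\<integral>x. f x *\<^sub>R exp (u x *\<^sub>R z) \<partial>M)"
proof -
  note absint = integrable_exp_abs[OF assms]
  show mom: "integrable M (\<lambda>x. f x * u x ^ k)" for k
  proof (rule Bochner_Integration.integrable_bound)
    show "integrable M (\<lambda>x. fact k * (\<bar>f x\<bar> * exp (1 * \<bar>u x\<bar>)))"
      by (intro integrable_mult_right absint)
    have le: "\<bar>u x\<bar> ^ k / fact k \<le> exp \<bar>u x\<bar>" for x
      using order.trans[OF member_le_sum[of k "{..<Suc k}" "\<lambda>k. \<bar>u x\<bar> ^ k / fact k"]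
          sum_power_over_fact_le_exp[of "\<bar>u x\<bar>" "Suc k"]] by simp
    show "AE x in M. norm (f x * u x ^ k) \<le> norm (fact k * (\<bar>f x\<bar> * exp (1 * \<bar>u x\<bar>)))"
    proof (intro AE_I2)
      fix x
      have "\<bar>f x\<bar> * \<bar>u x\<bar> ^ k \<le> \<bar>f x\<bar> * (fact k * exp \<bar>u x\<bar>)"
        using le[of x] by (intro mult_left_mono) (auto simp: field_simps)
      thus "norm (f x * u x ^ k) \<le> norm (fact k * (\<bar>f x\<bar> * exp (1 * \<bar>u x\<bar>)))"
        by (simp add: abs_mult power_abs mult_ac)
    qed
  qed measurable
  define g where "g k x = ((f x * u x ^ k) / fact k) *\<^sub>R z ^ k" for k x
  have ng: "norm (g k x) = \<bar>f x\<bar> * ((\<bar>u x\<bar> * norm z) ^ k / fact k)" for k x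
    unfolding g_def norm_scaleR norm_power abs_mult abs_divide power_abs[symmetric] power_mult_distrib
    by simp
  have gint: "integrable M (g k)" for k
    unfolding g_def by (intro integrable_scaleR_left integrable_divide mom)
  have sm: "summable (\<lambda>k. norm (g k x))" for x
    unfolding ng using summable_exp[of "\<bar>u x\<bar> * norm z"]
    by (intro summable_mult) (simp add: divide_inverse_commute)
  have "(\<lambda>k. integral\<^sup>L M (g k)) sums (\<integral>x. (\<Sum>k. g k x) \<partial>M)"
  proof (rule sums_integral)
    show "summable (\<lambda>k. \<integral>x. norm (g k x) \<partial>M)"
    proof (rule summableI_nonneg_bounded)
      fix n
      have "(\<Sum>k<n. \<integral>x. norm (g k x) \<partial>M) = (\<integral>x. (\<Sum>k<n. norm (g k x)) \<partial>M)"
        using gint by (intro Bochner_Integration.integral_sum[symmetric]) auto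
      also have "\<dots> \<le> (\<integral>x. \<bar>f x\<bar> * exp (norm z * \<bar>u x\<bar>) \<partial>M)"
      proof (intro integral_mono absint Bochner_Integration.integrable_sum integrable_norm gint)
        fix x
        show "(\<Sum>k<n. norm (g k x)) \<le> \<bar>f x\<bar> * exp (norm z * \<bar>u x\<bar>)"
          using sum_power_over_fact_le_exp[of "\<bar>u x\<bar> * norm z" n]
          unfolding ng sum_distrib_left[symmetric] mult.commute[of "norm z"]
          by (intro mult_left_mono) auto
      qed
      finally show "(\<Sum>k<n. \<integral>x. norm (g k x) \<partial>M) \<le> (\<integral>x. \<bar>f x\<bar> * exp (norm z * \<bar>u x\<bar>) \<partial>M)" .
    qed simp
  qed (use gint sm in auto)
  moreover have "(\<Sum>k. g k x) = f x *\<^sub>R exp (u x *\<^sub>R z)" for x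
  proof -
    have "(\<lambda>k. f x *\<^sub>R ((u x *\<^sub>R z) ^ k /\<^sub>R fact k)) sums (f x *\<^sub>R exp (u x *\<^sub>R z))"
      by (intro sums_scaleR_right exp_converges)
    thus ?thesis by (simp add: sums_iff g_def scaleR_power divide_inverse mult_ac)
  qed
  moreover have "integral\<^sup>L M (g k) = ((\<integral>x. f x * u x ^ k \<partial>M) / fact k) *\<^sub>R z ^ k" for k
    using mom[of k] unfolding g_def by (subst integral_scaleR_left) auto
  ultimately show "(\<lambda>k. ((\<integral>x. f x * u x ^ k \<partial>M) / fact k) *\<^sub>R z ^ k) sums
         (\<integral>x. f x *\<^sub>R exp (u x *\<^sub>R z) \<partial>M)" by simp
qed

text \<open>Once all lower coefficients vanish, the series may be divided by \<open>t ^ k\<close>,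
  and its limit at 0 is the coefficient \<open>a k\<close>.\<close>

lemma powser_eq_0_imp_coeff_eq_0:
  fixes a :: "nat \<Rightarrow> real"
  assumes "\<And>t. (\<lambda>k. a k * t ^ k) sums 0"
  shows "a k = 0"
proof (induction k rule: less_induct)
  case (less k)
  have "(\<lambda>i. a (i + k) * t ^ i) sums 0" if "t \<noteq> 0" for t
  proof -
    have "(\<lambda>i. a (i + k) * t ^ (i + k)) sums (0 - (\<Sum>i<k. a i * t ^ i))"
      by (rule sums_split_initial_segment[OF assms])
    hence "(\<lambda>i. (a (i + k) * t ^ (i + k)) / t ^ k) sums (0 / t ^ k)"
      using less by (intro sums_divide) simp
    thus ?thesis using that by (simp add: power_add)
  qed
  hence "((\<lambda>_. 0) \<longlongrightarrow> a (0 + k)) (at (0::real))"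
    by (intro powser_limit_0_strong[of 1 "\<lambda>i. a (i + k)"]) auto
  thus "a k = 0" using tendsto_const_iff[of "at (0::real)" 0 "a k"] by simp
qed

text \<open>Everywhere finite moment generating functions are power series in the moments. Their
  equality forces equal moments, hence equal characteristic functions, and Levy's uniqueness theorem
  applies after normalisation.\<close>

lemma measure_eqI_mgf:
  fixes M N :: "real measure"
  assumes "finite_measure M" "finite_measure N" and sets [simp]: "sets M = sets borel" "sets N = sets borel"
    and intM: "\<And>t. integrable M (\<lambda>x. exp (t * x))" and intN: "\<And>t. integrable N (\<lambda>x. exp (t * x))"
    and eq: "\<And>t. (\<integral>x. exp (t * x) \<partial>M) = (\<integral>x. exp (t * x) \<partial>N)"
  shows "M = N"
proof -
  interpret M: finite_measure M by fact
  interpret N: finite_measure N by fact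
  have sp: "space M = UNIV" "space N = UNIV" using sets by (metis sets_eq_imp_space_eq space_borel)+
  have [measurable_cong]: "sets M = sets borel" "sets N = sets borel" by simp_all
  define c where "c = measure M UNIV"
  have cN: "measure N UNIV = c" using eq[of 0] by (simp add: c_def sp)
  show ?thesis
  proof (cases "c = 0")
    case True
    hence "emeasure M UNIV = 0" "emeasure N UNIV = 0"
      using cN by (auto simp: c_def M.emeasure_eq_measure N.emeasure_eq_measure)
    hence "emeasure M X = 0" "emeasure N X = 0" for X
      using emeasure_mono[of X UNIV M] emeasure_mono[of X UNIV N] by auto
    thus ?thesis by (intro measure_eqI) auto
  next
    case False
    hence c: "c > 0" unfolding c_def by (simp add: order_less_le)
    \<comment> \<open>Both measures have the same total mass \<open>c\<close>, so the same factor
      turns both into probability measures.\<close>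
    define M' where "M' = density M (\<lambda>_. ennreal (1 / c))"
    define N' where "N' = density N (\<lambda>_. ennreal (1 / c))"
    have "real_distribution M'"
    proof (intro real_distribution.intro real_distribution_axioms.intro prob_spaceI)
      show "emeasure M' (space M') = 1"
        using c by (simp add: M'_def emeasure_density sp M.emeasure_eq_measure c_def[symmetric] flip: ennreal_mult)
    qed (auto simp: M'_def)
    moreover have "real_distribution N'"
    proof (intro real_distribution.intro real_distribution_axioms.intro prob_spaceI)
      show "emeasure N' (space N') = 1"
        using c by (simp add: N'_def emeasure_density sp N.emeasure_eq_measure cN flip: ennreal_mult)
    qed (auto simp: N'_def)
    moreover have "char M' = char N'"
    proof
      fix t :: real
      have mom: "(\<integral>x. x ^ k \<partial>M) = (\<integral>x. x ^ k \<partial>N)" for k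
      proof -
        have "(\<lambda>k. ((\<integral>x. x ^ k \<partial>M) / fact k - (\<integral>x. x ^ k \<partial>N) / fact k) * s ^ k) sums 0" for s
        proof -
          have "(\<lambda>k. (\<integral>x. x ^ k \<partial>M) / fact k * s ^ k) sums (\<integral>x. exp (s * x) \<partial>M)"
            using exp_integral_sums[of "\<lambda>_. 1" M "\<lambda>x. x" s] intM by (simp add: mult.commute[of s])
          moreover have "(\<lambda>k. (\<integral>x. x ^ k \<partial>N) / fact k * s ^ k) sums (\<integral>x. exp (s * x) \<partial>N)"
            using exp_integral_sums[of "\<lambda>_. 1" N "\<lambda>x. x" s] intN by (simp add: mult.commute[of s])
          ultimately show ?thesis
            unfolding left_diff_distrib using sums_diff eq[of s] by fastforce
        qed
        from powser_eq_0_imp_coeff_eq_0[OF this, of k] show ?thesis by simp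
      qed
      \<comment> \<open>With this \<open>z\<close> the integrand \<open>exp (x *\<^sub>R z)\<close>
        is that of the characteristic function at \<open>t\<close>.\<close>
      define z where "z = \<i> * complex_of_real t"
      have "(\<lambda>k. ((\<integral>x. x ^ k \<partial>M) / fact k) *\<^sub>R z ^ k) sums (\<integral>x. exp (x *\<^sub>R z) \<partial>M)"
        using exp_integral_sums[of "\<lambda>_. 1" M "\<lambda>x. x" z] intM by simp
      moreover have "(\<lambda>k. ((\<integral>x. x ^ k \<partial>N) / fact k) *\<^sub>R z ^ k) sums (\<integral>x. exp (x *\<^sub>R z) \<partial>N)"
        using exp_integral_sums[of "\<lambda>_. 1" N "\<lambda>x. x" z] intN by simp
      ultimately have "(\<integral>x. exp (x *\<^sub>R z) \<partial>M) = (\<integral>x. exp (x *\<^sub>R z) \<partial>N)"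
        unfolding mom by (rule sums_unique2)
      thus "char M' t = char N' t"
        using c unfolding char_def M'_def N'_def
        by (subst (1 2) integral_density) (auto simp: z_def scaleR_conv_of_real mult_ac)
    qed
    ultimately have "M' = N'" by (rule Levy_uniqueness)
    hence "density M' (\<lambda>_. ennreal c) = density N' (\<lambda>_. ennreal c)" by simp
    thus ?thesis using c by (simp add: M'_def N'_def density_density_eq density_1 flip: ennreal_mult)
  qed
qed

text \<open>The positive and negative parts of \<open>f\<close>, taken as densities and pushed
  forward by \<open>u\<close>, are finite measures on the line with equal moment generating
  functions, so they coincide.\<close>

lemma mgf_eq_0_imp_integral_eq_0_real:
  fixes f u :: "'a \<Rightarrow> real"
  assumes [measurable]: "f \<in> borel_measurable M" "u \<in> borel_measurable M"
    and int: "\<And>t. integrable M (\<lambda>x. f x * exp (t * u x))"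
    and zero: "\<And>t. (\<integral>x. f x * exp (t * u x) \<partial>M) = 0"
    and [measurable]: "B \<in> sets borel"
  shows "(\<integral>x. f x * indicator B (u x) \<partial>M) = 0"
proof -
  define P where "P g = distr (density M (\<lambda>x. ennreal (g x))) borel u" for g :: "'a \<Rightarrow> real"
  have fint: "integrable M f" using int[of 0] by simp
  have pint: "integrable M (\<lambda>x. max 0 (f x) * exp (t * u x))"
    "integrable M (\<lambda>x. max 0 (- f x) * exp (t * u x))" for t
    by (rule Bochner_Integration.integrable_bound[OF int[of t]]; auto simp: abs_mult)+
  have fin: "finite_measure (P g)" if [measurable]: "integrable M g" for g
  proof (intro finite_measureI)
    have "emeasure (P g) (space (P g)) = (\<integral>\<^sup>+x. ennreal (g x) \<partial>M)"
      by (simp add: P_def emeasure_distr emeasure_density space_density cong: nn_integral_cong)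
    thus "emeasure (P g) (space (P g)) \<noteq> \<infinity>"
      using that by (simp add: real_integrable_def)
  qed
  have intP: "integrable (P g) h \<longleftrightarrow> integrable M (\<lambda>x. g x * h (u x))"
    "integral\<^sup>L (P g) h = (\<integral>x. g x * h (u x) \<partial>M)"
    if [measurable]: "g \<in> borel_measurable M" "h \<in> borel_measurable borel" and "\<And>x. 0 \<le> g x"
    for g :: "'a \<Rightarrow> real" and h :: "real \<Rightarrow> real"
    using that(3) unfolding P_def
    by (simp_all add: integrable_distr_eq integral_distr integrable_density integral_density)
  have split: "f x * y = max 0 (f x) * y - max 0 (- f x) * y" for x y
    by (auto simp: max_def)
  have eq: "P (\<lambda>x. max 0 (f x)) = P (\<lambda>x. max 0 (- f x))"
  proof (rule measure_eqI_mgf)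
    fix t
    have "(\<integral>x. f x * exp (t * u x) \<partial>M) =
        (\<integral>x. max 0 (f x) * exp (t * u x) \<partial>M) - (\<integral>x. max 0 (- f x) * exp (t * u x) \<partial>M)"
      using pint by (subst split) (rule Bochner_Integration.integral_diff)
    thus "(\<integral>x. exp (t * x) \<partial>P (\<lambda>x. max 0 (f x))) = (\<integral>x. exp (t * x) \<partial>P (\<lambda>x. max 0 (- f x)))"
      using zero[of t] by (simp add: intP)
    show "finite_measure (P (\<lambda>x. max 0 (f x)))" "finite_measure (P (\<lambda>x. max 0 (- f x)))"
      using pint[of 0] by (auto intro!: fin)
  qed (use pint in \<open>simp_all add: intP(1), simp_all add: P_def\<close>)
  have "(\<integral>x. f x * indicator B (u x) \<partial>M) =
      (\<integral>x. max 0 (f x) * indicator B (u x) \<partial>M) - (\<integral>x. max 0 (- f x) * indicator B (u x) \<partial>M)"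
    by (subst split, rule Bochner_Integration.integral_diff;
        rule Bochner_Integration.integrable_bound[OF fint]; auto simp: indicator_def)
  also have "(\<integral>x. max 0 (f x) * indicator B (u x) \<partial>M) = integral\<^sup>L (P (\<lambda>x. max 0 (f x))) (indicator B)"
    by (subst intP) auto
  also have "(\<integral>x. max 0 (- f x) * indicator B (u x) \<partial>M) = integral\<^sup>L (P (\<lambda>x. max 0 (f x))) (indicator B)"
    by (subst eq, subst intP) auto
  finally show ?thesis by simp
qed

text \<open>The one-dimensional result is applied coordinate by coordinate to reach boxes, and a
  Dynkin argument passes from boxes to Borel sets.\<close>

lemma mgf_eq_0_imp_integral_eq_0:
  fixes f :: "'a \<Rightarrow> real" and V :: "'a \<Rightarrow> 'b::euclidean_space"
  assumes [measurable]: "f \<in> borel_measurable M" "V \<in> borel_measurable M"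
    and int: "\<And>\<theta>. integrable M (\<lambda>x. f x * exp (\<theta> \<bullet> V x))"
    and zero: "\<And>\<theta>. (\<integral>x. f x * exp (\<theta> \<bullet> V x) \<partial>M) = 0"
    and B: "B \<in> sets borel"
  shows "(\<integral>x. f x * indicator B (V x) \<partial>M) = 0"
proof -
  have fint: "integrable M f" using int[of 0] by simp
  \<comment> \<open>Exponentials are traded for indicators one coordinate at a time: in the
    induction step, varying \<open>\<theta> + t *\<^sub>R i\<close> gives the one-dimensional
    transform of \<open>f'\<close> along \<open>i\<close>.\<close>
  have prod: "(\<integral>x. f x * (\<Prod>i\<in>S. indicator (A i) (V x \<bullet> i)) * exp (\<theta> \<bullet> V x) \<partial>M) = 0"
    if "finite S" "S \<subseteq> Basis" "\<forall>i\<in>S. A i \<in> sets borel" "\<forall>i\<in>S. \<theta> \<bullet> i = 0"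
    for S \<theta> and A :: "'b \<Rightarrow> real set"
    using that
  proof (induction S arbitrary: \<theta>)
    case empty
    thus ?case using zero by simp
  next
    case (insert i S)
    have [measurable]: "A k \<in> sets borel" if "k \<in> S" for k using insert.prems that by simp
    define f' where "f' x = f x * (\<Prod>i\<in>S. indicator (A i) (V x \<bullet> i)) * exp (\<theta> \<bullet> V x)" for x
    have f': "f' x * exp (t * (V x \<bullet> i)) =
        f x * (\<Prod>i\<in>S. indicator (A i) (V x \<bullet> i)) * exp ((\<theta> + t *\<^sub>R i) \<bullet> V x)" for x t
      by (simp add: f'_def inner_add_left exp_add inner_commute[of "V x" i])
    have "(\<integral>x. f' x * indicator (A i) (V x \<bullet> i) \<partial>M) = 0"
    proof (rule mgf_eq_0_imp_integral_eq_0_real)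
      show "f' \<in> borel_measurable M" unfolding f'_def by measurable
      show "integrable M (\<lambda>x. f' x * exp (t * (V x \<bullet> i)))" for t
        unfolding f'
      proof (rule Bochner_Integration.integrable_bound[OF int[of "\<theta> + t *\<^sub>R i"]])
        show "AE x in M. norm (f x * (\<Prod>i\<in>S. indicator (A i) (V x \<bullet> i)) * exp ((\<theta> + t *\<^sub>R i) \<bullet> V x))
            \<le> norm (f x * exp ((\<theta> + t *\<^sub>R i) \<bullet> V x))"
        proof (intro AE_I2)
          fix x
          have "\<bar>\<Prod>i\<in>S. indicator (A i) (V x \<bullet> i) :: real\<bar> \<le> 1"
            unfolding abs_prod by (intro prod_le_1) (auto simp: indicator_def)
          hence "\<bar>f x * exp ((\<theta> + t *\<^sub>R i) \<bullet> V x)\<bar> * \<bar>\<Prod>i\<in>S. indicator (A i) (V x \<bullet> i) :: real\<bar>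
              \<le> \<bar>f x * exp ((\<theta> + t *\<^sub>R i) \<bullet> V x)\<bar>"
            by (rule mult_left_le) simp
          thus "norm (f x * (\<Prod>i\<in>S. indicator (A i) (V x \<bullet> i)) * exp ((\<theta> + t *\<^sub>R i) \<bullet> V x))
            \<le> norm (f x * exp ((\<theta> + t *\<^sub>R i) \<bullet> V x))"
            unfolding real_norm_def abs_mult by (simp only: mult_ac)
        qed
      qed measurable
      show "(\<integral>x. f' x * exp (t * (V x \<bullet> i)) \<partial>M) = 0" for t
        unfolding f' using insert
        by (intro insert.IH) (auto simp: inner_add_left inner_Basis subset_iff)
      show "A i \<in> sets borel" using insert.prems by simp
    qed measurable
    thus ?case using insert.hyps by (simp add: f'_def mult_ac)
  qed
  have box: "(\<integral>x. f x * indicator (box a b) (V x) \<partial>M) = 0" for a b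
  proof -
    have "indicator (box a b) v = (\<Prod>i\<in>Basis. indicator {a \<bullet> i<..<b \<bullet> i} (v \<bullet> i) :: real)" for v
      by (auto simp: indicator_def box_def intro!: prod.neutral)
    thus ?thesis using prod[of Basis "\<lambda>i. {a \<bullet> i<..<b \<bullet> i}" 0] by simp
  qed
  have ind: "integrable M (\<lambda>x. f x * indicator X (V x))" if [measurable]: "X \<in> sets borel" for X
    by (rule Bochner_Integration.integrable_bound[OF fint]) (auto simp: indicator_def)
  \<comment> \<open>Open boxes generate the Borel sets and are stable under intersection. Vanishing
    of the integral is preserved by complements and countable disjoint unions.\<close>
  have "B \<in> sigma_sets UNIV (range (\<lambda>(a, b). box a b))"
    using B by (simp add: borel_eq_box)
  thus ?thesis
  proof (induction rule: sigma_sets_induct_disjoint[rotated 2, consumes 1, case_names basic empty compl union])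
    case (basic A)
    thus ?case using box by auto
  next
    case empty
    show ?case by simp
  next
    case (compl A)
    hence A: "A \<in> sets borel" by (simp add: borel_eq_box)
    have "(\<integral>x. f x * indicator (UNIV - A) (V x) \<partial>M) = (\<integral>x. f x - f x * indicator A (V x) \<partial>M)"
      by (intro Bochner_Integration.integral_cong) (auto simp: indicator_def)
    also have "\<dots> = 0" using compl zero[of 0] fint ind[OF A] by simp
    finally show ?case .
  next
    case (union A)
    hence [measurable]: "A i \<in> sets borel" for i by (auto simp: borel_eq_box)
    have 0: "(LINT x:V -` A i \<inter> space M|M. f x) = 0" for i
      using union.IH[of i] unfolding set_lebesgue_integral_def
      by (subst Bochner_Integration.integral_cong[OF refl, where g = "\<lambda>x. f x * indicator (A i) (V x)"])
         (auto simp: indicator_def)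
    have "(\<integral>x. f x * indicator (\<Union>i. A i) (V x) \<partial>M) = (LINT x:(\<Union>i. V -` A i \<inter> space M)|M. f x)"
      unfolding set_lebesgue_integral_def
      by (intro Bochner_Integration.integral_cong) (auto simp: indicator_def)
    also have "\<dots> = (\<Sum>i. (LINT x:V -` A i \<inter> space M|M. f x))"
    proof (rule lebesgue_integral_countable_add)
      show "set_integrable M (\<Union>i. V -` A i \<inter> space M) f"
        unfolding set_integrable_def by (intro integrable_mult_indicator fint) measurable
    qed (use union(1) in \<open>auto simp: disjoint_family_on_def\<close>)
    finally show ?case by (simp add: 0)
  qed (auto simp: Int_stable_def box_Int_box)
qed


section \<open>Lebesgue measure along parallel lines\<close>

text \<open>This is the disintegration of Lebesgue measure along the lines with direction \<open>g\<close>; using the slab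
  \<open>0 \<le> a \<bullet> x \<le> 1\<close>, of thickness \<open>1\<close> along \<open>g\<close>, as the set of base points avoids choosing
  coordinates on a complement of \<open>g\<close>.\<close>

lemma lborel_eq_distr_slab_line:
  fixes a g :: "'a::euclidean_space"
  assumes ag: "a \<bullet> g = 1"
  shows "distr (density (lborel \<Otimes>\<^sub>M lborel) (\<lambda>(x, r). indicator {x. a \<bullet> x \<in> {0..1}} x))
      borel (\<lambda>(x, r). x + r *\<^sub>R g) = lborel"
proof (rule measure_eqI)
  fix A assume "A \<in> sets (distr (density (lborel \<Otimes>\<^sub>M lborel) (\<lambda>(x, r). indicator {x. a \<bullet> x \<in> {0..1}} x))
      borel (\<lambda>(x::'a, r). x + r *\<^sub>R g))"
  hence A[measurable]: "A \<in> sets borel" by simp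
  let ?I = "indicator {x. a \<bullet> x \<in> {0..1}} :: 'a \<Rightarrow> ennreal"
  have "emeasure (distr (density (lborel \<Otimes>\<^sub>M lborel) (\<lambda>(x, r). ?I x))
      borel (\<lambda>(x, r). x + r *\<^sub>R g)) A =
    (\<integral>\<^sup>+z. indicator A z \<partial>distr (density (lborel \<Otimes>\<^sub>M lborel) (\<lambda>(x, r). ?I x)) borel (\<lambda>(x, r). x + r *\<^sub>R g))"
    by simp
  also have "\<dots> = (\<integral>\<^sup>+z. (case z of (x, r) \<Rightarrow> ?I x * indicator A (x + r *\<^sub>R g)) \<partial>(lborel \<Otimes>\<^sub>M lborel))"
    by (subst nn_integral_distr, measurable, subst nn_integral_density, measurable)
       (auto intro!: nn_integral_cong)
  also have "\<dots> = (\<integral>\<^sup>+r. \<integral>\<^sup>+x. ?I x * indicator A (x + r *\<^sub>R g) \<partial>lborel \<partial>lborel)"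
    by (subst lborel_pair.nn_integral_snd[symmetric]) auto
  also have "\<dots> = (\<integral>\<^sup>+r. \<integral>\<^sup>+x. ?I (x - r *\<^sub>R g) * indicator A x \<partial>lborel \<partial>lborel)"
  proof (rule nn_integral_cong)
    fix r :: real
    have "(\<integral>\<^sup>+x. ?I (x - r *\<^sub>R g) * indicator A x \<partial>lborel) =
        (\<integral>\<^sup>+x. ?I (x - r *\<^sub>R g) * indicator A x \<partial>distr lborel borel ((+) (r *\<^sub>R g)))"
      by (simp add: lborel_distr_plus)
    also have "\<dots> = (\<integral>\<^sup>+x. ?I x * indicator A (x + r *\<^sub>R g) \<partial>lborel)"
      by (subst nn_integral_distr) (auto simp: add.commute)
    finally show "(\<integral>\<^sup>+x. ?I x * indicator A (x + r *\<^sub>R g) \<partial>lborel) =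
        (\<integral>\<^sup>+x. ?I (x - r *\<^sub>R g) * indicator A x \<partial>lborel)" ..
  qed
  also have "\<dots> = (\<integral>\<^sup>+x. \<integral>\<^sup>+r. ?I (x - r *\<^sub>R g) * indicator A x \<partial>lborel \<partial>lborel)"
    by (rule lborel_pair.Fubini') measurable
  \<comment> \<open>For fixed \<open>x\<close> the parameters \<open>r\<close> that move
    \<open>x\<close> back into the slab form an interval of length 1, because
    \<open>a \<bullet> g = 1\<close>. Thus every point has weight 1.\<close>
  also have "\<dots> = (\<integral>\<^sup>+x. indicator A x \<partial>lborel)"
  proof (rule nn_integral_cong)
    fix x
    have "(\<integral>\<^sup>+r. ?I (x - r *\<^sub>R g) * indicator A x \<partial>lborel) =
        (\<integral>\<^sup>+r. indicator {a \<bullet> x - 1..a \<bullet> x} r * indicator A x \<partial>lborel)"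
      by (intro nn_integral_cong) (auto simp: indicator_def inner_diff_right ag)
    also have "\<dots> = indicator A x"
      by (subst nn_integral_multc) auto
    finally show "(\<integral>\<^sup>+r. ?I (x - r *\<^sub>R g) * indicator A x \<partial>lborel) = indicator A x" .
  qed
  finally show "emeasure (distr (density (lborel \<Otimes>\<^sub>M lborel) (\<lambda>(x, r). ?I x))
      borel (\<lambda>(x, r). x + r *\<^sub>R g)) A = emeasure lborel A" by simp
qed simp

lemma AE_lborel_iff_AE_lines:
  fixes a g :: "'a::euclidean_space"
  assumes ag: "a \<bullet> g = 1" and [measurable]: "Measurable.pred borel P"
  shows "(AE x in lborel. P x) \<longleftrightarrow>
    (AE x in lborel. a \<bullet> x \<in> {0..1} \<longrightarrow> (AE r in lborel. P (x + r *\<^sub>R g)))"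
proof -
  have "(AE x in lborel. P x) \<longleftrightarrow>
     (AE z in lborel \<Otimes>\<^sub>M lborel. a \<bullet> fst z \<in> {0..1} \<longrightarrow> P (fst z + snd z *\<^sub>R g))"
    by (subst lborel_eq_distr_slab_line[OF ag, symmetric], subst AE_distr_iff, measurable,
        subst AE_density, measurable, intro AE_cong) (auto simp: indicator_def split: prod.splits)
  also have "\<dots> \<longleftrightarrow> (AE x in lborel. AE r in lborel. a \<bullet> x \<in> {0..1} \<longrightarrow> P (x + r *\<^sub>R g))"
  proof (rule lborel_pair.AE_pair_iff[symmetric, where P = "\<lambda>x r. a \<bullet> x \<in> {0..1} \<longrightarrow> P (x + r *\<^sub>R g)"])
    show "{x \<in> space (lborel \<Otimes>\<^sub>M lborel). a \<bullet> fst x \<in> {0..1} \<longrightarrow> P (fst x + snd x *\<^sub>R g)}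
      \<in> sets (lborel \<Otimes>\<^sub>M lborel)"
      by measurable
  qed
  also have "\<dots> \<longleftrightarrow> (AE x in lborel. a \<bullet> x \<in> {0..1} \<longrightarrow> (AE r in lborel. P (x + r *\<^sub>R g)))"
    by (intro AE_cong) auto
  finally show ?thesis .
qed

text \<open>Fubini for the slab disintegration: integrating over whole lines and then over base
  points in the slab recovers the full integral.\<close>

lemma
  fixes a g :: "'a::euclidean_space" and F :: "'a \<Rightarrow> real"
  assumes ag: "a \<bullet> g = 1" and F: "integrable lborel F"
  shows AE_integrable_lines:
      "AE x in lborel. a \<bullet> x \<in> {0..1} \<longrightarrow> integrable lborel (\<lambda>r. F (x + r *\<^sub>R g))"
    and integrable_slab_lines:
      "integrable lborel (\<lambda>x. indicator {x. a \<bullet> x \<in> {0..1}} x * (\<integral>r. F (x + r *\<^sub>R g) \<partial>lborel))"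
    and integral_slab_lines:
      "(\<integral>x. indicator {x. a \<bullet> x \<in> {0..1}} x * (\<integral>r. F (x + r *\<^sub>R g) \<partial>lborel) \<partial>lborel) = (\<integral>x. F x \<partial>lborel)"
proof -
  let ?I = "indicator {x. a \<bullet> x \<in> {0..1}} :: 'a \<Rightarrow> real"
  let ?D = "density (lborel \<Otimes>\<^sub>M lborel) (\<lambda>z. ennreal (?I (fst z)))"
  have D: "distr ?D borel (\<lambda>z. fst z + snd z *\<^sub>R g) = lborel"
    using lborel_eq_distr_slab_line[OF ag] by (simp add: case_prod_unfold ennreal_indicator)
  have [measurable]: "F \<in> borel_measurable borel" using F by simp
  have G: "integrable (lborel \<Otimes>\<^sub>M lborel) (\<lambda>z. ?I (fst z) * F (fst z + snd z *\<^sub>R g))"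
  proof -
    have "integrable (distr ?D borel (\<lambda>z. fst z + snd z *\<^sub>R g)) F" by (simp only: D F)
    thus ?thesis
      by (subst (asm) integrable_distr_eq, measurable, subst (asm) integrable_density) auto
  qed
  have G': "integrable (lborel \<Otimes>\<^sub>M lborel) (\<lambda>(x, r). ?I x * F (x + r *\<^sub>R g))"
    using G by (simp add: case_prod_unfold)
  show "AE x in lborel. a \<bullet> x \<in> {0..1} \<longrightarrow> integrable lborel (\<lambda>r. F (x + r *\<^sub>R g))"
    using lborel_pair.AE_integrable_fst'[OF G] by (rule AE_mp) (auto intro!: AE_I2)
  show "integrable lborel (\<lambda>x. ?I x * (\<integral>r. F (x + r *\<^sub>R g) \<partial>lborel))"
    using lborel_pair.integrable_fst'[OF G] by simp
  have "(\<integral>x. ?I x * (\<integral>r. F (x + r *\<^sub>R g) \<partial>lborel) \<partial>lborel) =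
      (\<integral>z. ?I (fst z) * F (fst z + snd z *\<^sub>R g) \<partial>(lborel \<Otimes>\<^sub>M lborel))"
    using lborel_pair.integral_fst'[OF G] by simp
  also have "\<dots> = integral\<^sup>L lborel F"
    by (subst (2) D[symmetric], subst integral_distr, measurable, subst integral_density) auto
  finally show "(\<integral>x. ?I x * (\<integral>r. F (x + r *\<^sub>R g) \<partial>lborel) \<partial>lborel) = (\<integral>x. F x \<partial>lborel)" .
qed


section \<open>Tests with convex acceptance sections\<close>

text \<open>A constant serves for the empty set and the whole line, an affine function vanishing at
  the end point for a half-line, and \<open>(r - Inf I) * (r - Sup I)\<close> for a bounded set.
  Finiteness of the zero set later allows division by the quadratic almost everywhere.\<close>

lemma convex_real_separating_quadratic:
  fixes I :: "real set"
  assumes "convex I"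
  obtains \<alpha> \<beta> \<gamma> where "0 \<le> \<gamma>" "\<And>r. r \<in> I \<Longrightarrow> \<alpha> + \<beta> * r + \<gamma> * r\<^sup>2 \<le> 0"
    "\<And>r. r \<notin> I \<Longrightarrow> 0 \<le> \<alpha> + \<beta> * r + \<gamma> * r\<^sup>2" "finite {r. \<alpha> + \<beta> * r + \<gamma> * r\<^sup>2 = 0}"
proof -
  have conv: "y \<in> I" if "x \<in> I" "z \<in> I" "x \<le> y" "y \<le> z" for x y z
    by (rule mem_is_interval_1_I[of I x z y]) (use assms that in \<open>simp_all add: is_interval_convex_1\<close>)
  consider (empty) "I = {}" | (UNIV) "I \<noteq> {}" "\<not> bdd_below I" "\<not> bdd_above I"
    | (above) "I \<noteq> {}" "\<not> bdd_below I" "bdd_above I"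
    | (below) "I \<noteq> {}" "bdd_below I" "\<not> bdd_above I"
    | (bounded) "I \<noteq> {}" "bdd_below I" "bdd_above I" by argo
  thus ?thesis
  proof cases
    case empty
    \<comment> \<open>Positional arguments of \<open>that\<close> come in the order \<gamma>,
      \<alpha>, \<beta>, since \<gamma> occurs first. Here the function is the constant 1.\<close>
    thus ?thesis by (intro that[of 0 1 0]) auto
  next
    case UNIV
    have "r \<in> I" for r
      using UNIV conv unfolding bdd_below_def bdd_above_def by (meson linear)
    thus ?thesis by (intro that[of 0 "-1" 0]) auto
  next
    case above
    have "r \<le> Sup I" if "r \<in> I" for r using that above by (simp add: cSup_upper)
    moreover have "Sup I \<le> r" if "r \<notin> I" for r
    proof (rule ccontr)
      assume "\<not> Sup I \<le> r"
      then obtain z where "z \<in> I" "r < z" using above less_cSup_iff by (metis not_le)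
      moreover obtain x where "x \<in> I" "x \<le> r" using above unfolding bdd_below_def by (meson linear)
      ultimately show False using conv that by (meson less_imp_le)
    qed
    ultimately show ?thesis by (intro that[of 0 "- Sup I" 1]) (auto simp: add_eq_0_iff)
  next
    case below
    have "Inf I \<le> r" if "r \<in> I" for r using that below by (simp add: cInf_lower)
    moreover have "r \<le> Inf I" if "r \<notin> I" for r
    proof (rule ccontr)
      assume "\<not> r \<le> Inf I"
      then obtain z where "z \<in> I" "z < r" using below cInf_less_iff by (metis not_le)
      moreover obtain x where "x \<in> I" "r \<le> x" using below unfolding bdd_above_def by (meson linear)
      ultimately show False using conv that by (meson less_imp_le)
    qed
    ultimately show ?thesis by (intro that[of 0 "Inf I" "-1"]) (auto simp: add_eq_0_iff)
  next
    case bounded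
    let ?a = "Inf I" and ?b = "Sup I"
    have eq: "?a * ?b + (- ?a - ?b) * r + 1 * r\<^sup>2 = (r - ?a) * (r - ?b)" for r
      by (simp add: power2_eq_square algebra_simps)
    have in_I: "?a \<le> r" "r \<le> ?b" if "r \<in> I" for r
      using that bounded by (simp_all add: cInf_lower cSup_upper)
    have notin_I: "r \<le> ?a \<or> ?b \<le> r" if "r \<notin> I" for r
    proof (rule ccontr)
      assume "\<not> (r \<le> ?a \<or> ?b \<le> r)"
      then obtain x z where "x \<in> I" "x < r" "z \<in> I" "r < z"
        using bounded cInf_less_iff less_cSup_iff by (metis not_le)
      thus False using conv that by (meson less_imp_le)
    qed
    have ab: "?a \<le> ?b" using bounded by (simp add: cInf_le_cSup)
    show ?thesis
    proof (rule that[of 1 "?a * ?b" "- ?a - ?b", unfolded eq])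
      fix r
      show "(r - ?a) * (r - ?b) \<le> 0" if "r \<in> I"
        using in_I[OF that] by (intro mult_nonneg_nonpos) auto
      show "0 \<le> (r - ?a) * (r - ?b)" if "r \<notin> I"
        using notin_I[OF that] ab by (auto intro: mult_nonneg_nonneg mult_nonpos_nonpos)
    next
      have "{r. (r - ?a) * (r - ?b) = 0} = {?a, ?b}" by auto
      thus "finite {r. (r - ?a) * (r - ?b) = 0}" by simp
    qed simp
  qed
qed

text \<open>Let \<open>Q\<close> be the separating quadratic of \<open>I\<close> in the shifted
  coordinate \<open>c + r\<close>. Then \<open>p r * Q r\<close> \<le> 0, and the vanishing moments
  reduce its integral to \<gamma> times the second moment. For \<gamma> > 0 the sign follows; for
  \<gamma> = 0 the integral is 0, so \<open>p\<close> vanishes almost everywhere.\<close>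

lemma
  fixes p :: "real \<Rightarrow> real"
  assumes int: "integrable lborel p" "integrable lborel (\<lambda>r. p r * (c + r))"
      "integrable lborel (\<lambda>r. p r * (c + r)\<^sup>2)"
    and I: "convex I" "\<And>r. r \<in> I \<Longrightarrow> 0 \<le> p r" "\<And>r. r \<notin> I \<Longrightarrow> p r \<le> 0"
    and zero: "(\<integral>r. p r \<partial>lborel) = 0" "(\<integral>r. p r * (c + r) \<partial>lborel) = 0"
  shows second_moment_nonpos: "(\<integral>r. p r * (c + r)\<^sup>2 \<partial>lborel) \<le> 0"
    and second_moment_eq_0_imp: "(\<integral>r. p r * (c + r)\<^sup>2 \<partial>lborel) = 0 \<Longrightarrow> AE r in lborel. p r = 0"
proof -
  have "convex ((+) c ` I)" using I(1) by simp
  then obtain \<gamma> \<alpha> \<beta> where q: "0 \<le> \<gamma>" "\<And>r. r \<in> (+) c ` I \<Longrightarrow> \<alpha> + \<beta> * r + \<gamma> * r\<^sup>2 \<le> 0"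
    "\<And>r. r \<notin> (+) c ` I \<Longrightarrow> 0 \<le> \<alpha> + \<beta> * r + \<gamma> * r\<^sup>2" "finite {r. \<alpha> + \<beta> * r + \<gamma> * r\<^sup>2 = 0}"
    by (rule convex_real_separating_quadratic) blast
  define Q where "Q r = \<alpha> + \<beta> * (c + r) + \<gamma> * (c + r)\<^sup>2" for r
  have Q: "p r * Q r \<le> 0" for r
  proof (cases "r \<in> I")
    case True
    thus ?thesis using q(2)[of "c + r"] I(2)[of r] by (simp add: Q_def mult_nonneg_nonpos)
  next
    case False
    hence "c + r \<notin> (+) c ` I" by auto
    thus ?thesis using q(3)[of "c + r"] I(3)[of r] False by (simp add: Q_def mult_nonpos_nonneg)
  qed
  have pQ: "p r * Q r = \<alpha> * p r + \<beta> * (p r * (c + r)) + \<gamma> * (p r * (c + r)\<^sup>2)" for r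
    by (simp add: Q_def algebra_simps)
  have iQ: "integrable lborel (\<lambda>r. p r * Q r)"
    unfolding pQ using int by auto
  have eQ: "(\<integral>r. p r * Q r \<partial>lborel) = \<gamma> * (\<integral>r. p r * (c + r)\<^sup>2 \<partial>lborel)"
    unfolding pQ using int by (simp add: zero)
  have "finite ((\<lambda>s. s - c) ` {r. \<alpha> + \<beta> * r + \<gamma> * r\<^sup>2 = 0})" using q(4) by simp
  hence "finite {r. Q r = 0}"
    by (rule rev_finite_subset) (auto simp: Q_def image_iff intro!: exI[of _ "c + _"])
  hence Qae: "AE r in lborel. Q r \<noteq> 0"
    using finite_imp_null_set_lborel[of "{r. Q r = 0}"] by (auto dest: AE_not_in)
  \<comment> \<open>The premise covers two situations: a vanishing second moment, and \<gamma> = 0,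
    where the separating function is affine.\<close>
  have p0: "AE r in lborel. p r = 0" if "\<gamma> * (\<integral>r. p r * (c + r)\<^sup>2 \<partial>lborel) = 0"
  proof -
    have "AE r in lborel. - (p r * Q r) = 0"
      using integral_nonneg_eq_0_iff_AE[of lborel "\<lambda>r. - (p r * Q r)"] iQ Q eQ that by auto
    thus ?thesis using Qae by eventually_elim simp
  qed
  show "AE r in lborel. p r = 0" if "(\<integral>r. p r * (c + r)\<^sup>2 \<partial>lborel) = 0"
    using p0 that by simp
  have "\<gamma> * (\<integral>r. p r * (c + r)\<^sup>2 \<partial>lborel) \<le> 0"
    using Bochner_Integration.integral_nonneg[of lborel "\<lambda>r. - (p r * Q r)"] Q eQ by simp
  moreover have "(\<integral>r. p r * (c + r)\<^sup>2 \<partial>lborel) = 0" if "\<gamma> = 0"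
  proof -
    have "AE r in lborel. p r * (c + r)\<^sup>2 = 0" using p0 that by auto
    thus ?thesis by (rule integral_eq_zero_AE)
  qed
  ultimately show "(\<integral>r. p r * (c + r)\<^sup>2 \<partial>lborel) \<le> 0"
    using q(1) by (auto simp: mult_le_0_iff)
qed

text \<open>The coefficients are the successive limits at 0 of \<open>D t\<close>,
  \<open>D t / t\<close> and \<open>D t / t\<^sup>2\<close>. The second quotient is nonnegative to
  the right of 0 and nonpositive to the left, so its limit is 0.\<close>

lemma
  fixes a :: "nat \<Rightarrow> real"
  assumes sums: "\<And>t. (\<lambda>k. a k * t ^ k) sums D t"
    and nonneg: "\<And>t. t \<noteq> 0 \<Longrightarrow> 0 \<le> D t" and "D 0 \<le> 0"
  shows powser_min_at_0_coeffs: "a 0 = 0" "a 1 = 0" "0 \<le> a 2"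
proof -
  have "a 0 = D 0" using sums[of 0] by simp
  moreover have "(D \<longlongrightarrow> a 0) (at 0)"
    using powser_limit_0_strong[of 1 a D] sums by auto
  hence "0 \<le> a 0"
    by (rule tendsto_lowerbound) (auto simp: eventually_at_filter nonneg)
  ultimately show 0: "a 0 = 0" using assms(3) by simp
  have D1: "(\<lambda>k. a (k + 1) * t ^ k) sums (D t / t)" if "t \<noteq> 0" for t
    using sums_divide[OF sums_split_initial_segment[OF sums[of t], of 1], of t] that 0 by simp
  have lim1: "((\<lambda>t. D t / t) \<longlongrightarrow> a (0 + 1)) (at 0)"
    using powser_limit_0_strong[of 1 "\<lambda>k. a (k + 1)" "\<lambda>t. D t / t"] D1 by auto
  have "0 \<le> a 1"
    using tendsto_mono[OF at_le[of "{0<..}" UNIV] lim1]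
    by (intro tendsto_lowerbound[of "\<lambda>t. D t / t" _ "at_right 0"])
       (auto simp: eventually_at_filter nonneg)
  moreover have "a 1 \<le> 0"
    using tendsto_mono[OF at_le[of "{..<0}" UNIV] lim1]
    by (intro tendsto_upperbound[of "\<lambda>t. D t / t" _ "at_left 0"])
       (auto simp: eventually_at_filter nonneg divide_nonneg_neg)
  ultimately show 1: "a 1 = 0" by simp
  have D2: "(\<lambda>k. a (k + 2) * t ^ k) sums (D t / t\<^sup>2)" if "t \<noteq> 0" for t
    using sums_divide[OF sums_split_initial_segment[OF D1[of t], of 1], of t] that 1
    by (simp add: power2_eq_square)
  have "((\<lambda>t. D t / t\<^sup>2) \<longlongrightarrow> a (0 + 2)) (at 0)"
    using powser_limit_0_strong[of 1 "\<lambda>k. a (k + 2)" "\<lambda>t. D t / t\<^sup>2"] D2 by auto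
  hence "((\<lambda>t. D t / t\<^sup>2) \<longlongrightarrow> a 2) (at 0)" by (simp add: numeral_2_eq_2)
  thus "0 \<le> a 2"
    by (rule tendsto_lowerbound) (auto simp: eventually_at_filter nonneg)
qed

text \<open>The map \<open>x \<mapsto> x - (a \<bullet> x) g\<close> is the projection along \<open>g\<close>; sets of the form \<open>{x. x - (a \<bullet> x) g \<in> B}\<close>
  are unions of lines with direction \<open>g\<close>.\<close>

lemma AE_line_integral_nonpos:
  fixes a g :: "'a::euclidean_space" and F :: "'a \<Rightarrow> real"
  assumes ag: "a \<bullet> g = 1" and F: "integrable lborel F"
    and zero: "\<And>B. B \<in> sets borel \<Longrightarrow> (\<integral>x. F x * indicator B (x - (a \<bullet> x) *\<^sub>R g) \<partial>lborel) = 0"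
  shows "AE x in lborel. a \<bullet> x \<in> {0..1} \<longrightarrow> (\<integral>r. F (x + r *\<^sub>R g) \<partial>lborel) \<le> 0"
proof -
  let ?I = "indicator {x. a \<bullet> x \<in> {0..1}} :: 'a \<Rightarrow> real"
  have [measurable]: "F \<in> borel_measurable borel" using F by simp
  define K where "K x = (\<integral>r. F (x + r *\<^sub>R g) \<partial>lborel)" for x
  have [measurable]: "K \<in> borel_measurable borel" unfolding K_def by measurable
  \<comment> \<open>Translation invariance makes \<open>K\<close> a function of the line
    alone.\<close>
  have K_line: "K (x + s *\<^sub>R g) = K x" for x s
    using lborel_integral_real_affine[of 1 "\<lambda>r. F (x + r *\<^sub>R g)" s]
    by (simp add: K_def algebra_simps)
  \<comment> \<open>Testing \<open>zero\<close> against the union of all lines with positive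
    integral isolates the positive part of \<open>K\<close>, whose integral over the slab must then
    vanish.\<close>
  define B where "B = {v. 0 < K v}"
  have B[measurable]: "B \<in> sets borel" unfolding B_def by measurable
  define G where "G x = F x * indicator B (x - (a \<bullet> x) *\<^sub>R g)" for x
  have G: "integrable lborel G"
    unfolding G_def by (rule Bochner_Integration.integrable_bound[OF F]) (auto simp: indicator_def)
  have GK: "(\<integral>r. G (x + r *\<^sub>R g) \<partial>lborel) = max 0 (K x)" for x
  proof -
    have "G (x + r *\<^sub>R g) = F (x + r *\<^sub>R g) * indicator B x" for r
      using K_line[of x "- (a \<bullet> x)"]
      by (simp add: G_def B_def indicator_def inner_add_right ag algebra_simps)
    thus ?thesis by (auto simp: K_def[symmetric] B_def indicator_def)
  qed
  have "(\<integral>x. ?I x * max 0 (K x) \<partial>lborel) = 0"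
    using integral_slab_lines[OF ag G] zero[OF B] unfolding GK by (simp add: G_def)
  moreover have "integrable lborel (\<lambda>x. ?I x * max 0 (K x))"
    using integrable_slab_lines[OF ag G] by (simp add: GK)
  ultimately have "AE x in lborel. ?I x * max 0 (K x) = 0"
    by (subst (asm) integral_nonneg_eq_0_iff_AE) auto
  thus ?thesis
    by eventually_elim (auto simp: K_def indicator_def max_def split: if_splits)
qed

lemma AE_line_integral_eq_0:
  fixes a g :: "'a::euclidean_space" and F :: "'a \<Rightarrow> real"
  assumes ag: "a \<bullet> g = 1" and F: "integrable lborel F"
    and zero: "\<And>B. B \<in> sets borel \<Longrightarrow> (\<integral>x. F x * indicator B (x - (a \<bullet> x) *\<^sub>R g) \<partial>lborel) = 0"
  shows "AE x in lborel. a \<bullet> x \<in> {0..1} \<longrightarrow> (\<integral>r. F (x + r *\<^sub>R g) \<partial>lborel) = 0"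
  using AE_line_integral_nonpos[OF assms] AE_line_integral_nonpos[OF ag, of "\<lambda>x. - F x"] F zero
  by (auto elim: eventually_elim2)

text \<open>The Matthes-Truax argument for an arbitrary positive weight \<open>w\<close> with finite
  Laplace transform; \<eta> is the natural parameter, and the null hypothesis is the hyperplane
  orthogonal to \<open>g\<close>.\<close>

theorem convex_sections_test_unique:
  fixes w \<phi> \<phi>' :: "'a::euclidean_space \<Rightarrow> real" and g :: 'a
  assumes [measurable]: "w \<in> borel_measurable borel" "\<phi> \<in> borel_measurable borel" "\<phi>' \<in> borel_measurable borel"
    and w: "\<And>x. 0 < w x" "\<And>\<eta>. integrable lborel (\<lambda>x. w x * exp (\<eta> \<bullet> x))"
    and \<phi>: "\<And>x. \<phi> x = 0 \<or> \<phi> x = 1" and \<phi>': "\<And>x. 0 \<le> \<phi>' x" "\<And>x. \<phi>' x \<le> 1"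
    and g: "g \<noteq> 0" and convex: "AE x in lborel. convex {r. \<phi> (x + r *\<^sub>R g) = 0}"
    and null: "\<And>\<eta>. \<eta> \<bullet> g = 0 \<Longrightarrow>
        (\<integral>x. \<phi>' x * (w x * exp (\<eta> \<bullet> x)) \<partial>lborel) \<le> (\<integral>x. \<phi> x * (w x * exp (\<eta> \<bullet> x)) \<partial>lborel)"
    and alt: "\<And>\<eta>. \<eta> \<bullet> g \<noteq> 0 \<Longrightarrow>
        (\<integral>x. \<phi> x * (w x * exp (\<eta> \<bullet> x)) \<partial>lborel) \<le> (\<integral>x. \<phi>' x * (w x * exp (\<eta> \<bullet> x)) \<partial>lborel)"
  shows "AE x in lborel. \<phi>' x = \<phi> x"
proof -
  \<comment> \<open>The normalisation \<open>a \<bullet> g = 1\<close> gives \<open>a\<close> two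
    roles: adding \<open>t *\<^sub>R a\<close> to \<eta> raises \<open>\<eta> \<bullet> g\<close> by
    \<open>t\<close>, and \<open>a \<bullet> x\<close> is a unit-speed coordinate along lines with
    direction \<open>g\<close>.\<close>
  define a where "a = g /\<^sub>R (g \<bullet> g)"
  have ag: "a \<bullet> g = 1" using g by (simp add: a_def)
  define f where "f x = (\<phi>' x - \<phi> x) * w x" for x
  have [measurable]: "f \<in> borel_measurable borel" unfolding f_def by measurable
  have bound: "integrable lborel (\<lambda>x. h x * (w x * exp (\<eta> \<bullet> x)))"
    if [measurable]: "h \<in> borel_measurable borel" and "\<And>x. \<bar>h x\<bar> \<le> 1" for h \<eta>
    by (rule Bochner_Integration.integrable_bound[OF w(2)[of \<eta>]])
       (use that w(1) in \<open>auto simp: abs_mult intro!: mult_left_le_one_le\<close>)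
  have abs: "\<bar>\<phi> x\<bar> \<le> 1" "\<bar>\<phi>' x\<bar> \<le> 1" for x using \<phi>[of x] \<phi>'[of x] by auto
  have f_eq: "f x * exp (\<eta> \<bullet> x) = \<phi>' x * (w x * exp (\<eta> \<bullet> x)) - \<phi> x * (w x * exp (\<eta> \<bullet> x))" for x \<eta>
    by (simp add: f_def algebra_simps)
  have int: "integrable lborel (\<lambda>x. f x * exp (\<eta> \<bullet> x))" for \<eta>
    unfolding f_eq using abs by (intro Bochner_Integration.integrable_diff bound) auto
  define D where "D \<eta> = (\<integral>x. f x * exp (\<eta> \<bullet> x) \<partial>lborel)" for \<eta>
  have D_eq: "D \<eta> = (\<integral>x. \<phi>' x * (w x * exp (\<eta> \<bullet> x)) \<partial>lborel) - (\<integral>x. \<phi> x * (w x * exp (\<eta> \<bullet> x)) \<partial>lborel)" for \<eta>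
    unfolding D_def f_eq using abs by (intro Bochner_Integration.integral_diff bound) auto
  have expand: "f x * exp (\<eta> \<bullet> x) * exp (t * (a \<bullet> x)) = f x * exp ((\<eta> + t *\<^sub>R a) \<bullet> x)" for \<eta> t x
    by (simp add: inner_add_left exp_add)
  have mom: "integrable lborel (\<lambda>x. f x * exp (\<eta> \<bullet> x) * (a \<bullet> x) ^ k)" for \<eta> k
    by (rule integrable_moment) (auto simp: expand int)
  define m where "m \<eta> k = (\<integral>x. f x * exp (\<eta> \<bullet> x) * (a \<bullet> x) ^ k \<partial>lborel)" for \<eta> k
  \<comment> \<open>Crossing the hyperplane along \<open>a\<close>, \<open>D\<close> is a power
    series in \<open>t\<close> with coefficients \<open>m \<eta> k / fact k\<close>, nonnegative for
    \<open>t\<close> \<noteq> 0 and nonpositive at 0.\<close>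
  have m: "m \<eta> 0 = 0" "m \<eta> 1 = 0" "0 \<le> m \<eta> 2" if "\<eta> \<bullet> g = 0" for \<eta>
  proof -
    have sums: "(\<lambda>k. m \<eta> k / fact k * t ^ k) sums D (\<eta> + t *\<^sub>R a)" for t
      using exp_integral_sums[of "\<lambda>x. f x * exp (\<eta> \<bullet> x)" lborel "\<lambda>x. a \<bullet> x" t]
      by (simp add: mult.commute[of _ t] expand int m_def D_def)
    have pos: "0 \<le> D (\<eta> + t *\<^sub>R a)" if "t \<noteq> 0" for t
      using alt[of "\<eta> + t *\<^sub>R a"] that \<open>\<eta> \<bullet> g = 0\<close> by (simp add: D_eq inner_add_left ag)
    have neg: "D (\<eta> + 0 *\<^sub>R a) \<le> 0"
      using null that by (simp add: D_eq)
    show "m \<eta> 0 = 0" "m \<eta> 1 = 0" "0 \<le> m \<eta> 2"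
      using powser_min_at_0_coeffs[OF sums pos neg] by simp_all
  qed
  \<comment> \<open>The Laplace transform in the projected variable only involves parameters in the
    hyperplane, which is exactly where \<open>m\<close> gives vanishing moments.\<close>
  have V: "\<theta> \<bullet> (x - (a \<bullet> x) *\<^sub>R g) = (\<theta> - (\<theta> \<bullet> g) *\<^sub>R a) \<bullet> x" for \<theta> x
    by (simp add: inner_diff_left inner_diff_right)
  have perp: "(\<theta> - (\<theta> \<bullet> g) *\<^sub>R a) \<bullet> g = 0" for \<theta> by (simp add: inner_diff_left ag)
  have vanish: "(\<integral>x. (f x * (a \<bullet> x) ^ k) * indicator B (x - (a \<bullet> x) *\<^sub>R g) \<partial>lborel) = 0"
    if "k \<le> 1" "B \<in> sets borel" for k B
  proof (rule mgf_eq_0_imp_integral_eq_0)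
    have comm: "f x * (a \<bullet> x) ^ k * exp (\<eta> \<bullet> x) = f x * exp (\<eta> \<bullet> x) * (a \<bullet> x) ^ k" for \<eta> x by simp
    fix \<theta>
    show "integrable lborel (\<lambda>x. f x * (a \<bullet> x) ^ k * exp (\<theta> \<bullet> (x - (a \<bullet> x) *\<^sub>R g)))"
      unfolding V comm by (rule mom)
    have "k = 0 \<or> k = 1" using that by auto
    thus "(\<integral>x. f x * (a \<bullet> x) ^ k * exp (\<theta> \<bullet> (x - (a \<bullet> x) *\<^sub>R g)) \<partial>lborel) = 0"
      unfolding V comm m_def[symmetric] using m[OF perp] by auto
  qed (use that in measurable)
  have F: "integrable lborel (\<lambda>x. f x * (a \<bullet> x) ^ k)" for k
    using mom[of 0 k] by simp
  \<comment> \<open>\<open>K k x\<close> is the \<open>k\<close>-th moment of \<open>f\<close> on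
    the line through \<open>x\<close>, in the coordinate \<open>a \<bullet> x + r\<close>.\<close>
  define K where "K k x = (\<integral>r. f (x + r *\<^sub>R g) * (a \<bullet> x + r) ^ k \<partial>lborel)" for k x
  have line: "a \<bullet> (x + r *\<^sub>R g) = a \<bullet> x + r" for x r by (simp add: inner_add_right ag)
  have K01: "AE x in lborel. a \<bullet> x \<in> {0..1} \<longrightarrow> K k x = 0" if "k \<le> 1" for k
    using AE_line_integral_eq_0[OF ag F vanish[OF that]] by (simp add: K_def line)
  have Kint: "AE x in lborel. a \<bullet> x \<in> {0..1} \<longrightarrow> integrable lborel (\<lambda>r. f (x + r *\<^sub>R g) * (a \<bullet> x + r) ^ k)" for k
    using AE_integrable_lines[OF ag F[of k]] by (simp add: line)
  note ev = K01[of 0, simplified] K01[of 1, simplified] Kint[of 0, simplified] Kint[of 1, simplified]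
    Kint[of 2, simplified] convex
  have sgn: "0 \<le> f x" if "\<phi> x = 0" for x
    using that \<phi>'(1)[of x] w(1)[of x] by (simp add: f_def)
  have sgn': "f x \<le> 0" if "\<phi> x \<noteq> 0" for x
    using that \<phi>'(2)[of x] \<phi>[of x] w(1)[of x] by (auto simp: f_def mult_le_0_iff)
  let ?I = "indicator {x. a \<bullet> x \<in> {0..1}} :: 'a \<Rightarrow> real"
  have K2: "AE x in lborel. a \<bullet> x \<in> {0..1} \<longrightarrow>
      K 2 x \<le> 0 \<and> (K 2 x = 0 \<longrightarrow> (AE r in lborel. f (x + r *\<^sub>R g) = 0))"
    using ev
  proof eventually_elim
    case (elim x)
    show ?case
    proof
      assume x: "a \<bullet> x \<in> {0..1}"
      have *: "integrable lborel (\<lambda>r. f (x + r *\<^sub>R g))"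
        "integrable lborel (\<lambda>r. f (x + r *\<^sub>R g) * (a \<bullet> x + r))"
        "integrable lborel (\<lambda>r. f (x + r *\<^sub>R g) * (a \<bullet> x + r)\<^sup>2)"
        "(\<integral>r. f (x + r *\<^sub>R g) \<partial>lborel) = 0"
        "(\<integral>r. f (x + r *\<^sub>R g) * (a \<bullet> x + r) \<partial>lborel) = 0"
        using x elim by (simp_all add: K_def)
      show "K 2 x \<le> 0 \<and> (K 2 x = 0 \<longrightarrow> (AE r in lborel. f (x + r *\<^sub>R g) = 0))"
        unfolding K_def
        using second_moment_nonpos[OF *(1-3) elim(6) _ _ *(4,5)]
          second_moment_eq_0_imp[OF *(1-3) elim(6) _ _ *(4,5)] sgn sgn' by simp
    qed
  qed
  have slab2: "(\<integral>x. - (?I x * K 2 x) \<partial>lborel) = - m 0 2"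
    using integral_slab_lines[OF ag F[of 2]] by (simp add: K_def line m_def)
  \<comment> \<open>The line moments \<open>K 2 x\<close> are almost all nonpositive, yet their
    total \<open>m 0 2\<close> is nonnegative; hence almost all of them vanish.\<close>
  have "0 \<le> (\<integral>x. - (?I x * K 2 x) \<partial>lborel)"
    using K2 by (intro integral_nonneg_AE) (auto elim!: eventually_mono simp: indicator_def)
  hence "(\<integral>x. - (?I x * K 2 x) \<partial>lborel) = 0"
    using m(3)[of 0] slab2 by simp
  moreover have "integrable lborel (\<lambda>x. - (?I x * K 2 x))"
    using integrable_slab_lines[OF ag F[of 2]] by (simp add: K_def line)
  moreover have "AE x in lborel. 0 \<le> - (?I x * K 2 x)"
    using K2 by (auto elim!: eventually_mono simp: indicator_def)
  ultimately have "AE x in lborel. - (?I x * K 2 x) = 0"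
    by (subst (asm) integral_nonneg_eq_0_iff_AE)
  hence "AE x in lborel. a \<bullet> x \<in> {0..1} \<longrightarrow> (AE r in lborel. f (x + r *\<^sub>R g) = 0)"
    using K2 by eventually_elim (auto simp: indicator_def)
  hence "AE x in lborel. f x = 0"
    by (subst AE_lborel_iff_AE_lines[OF ag]) auto
  thus ?thesis
  proof eventually_elim
    case (elim x)
    thus ?case using w(1)[of x] by (simp add: f_def)
  qed
qed


section \<open>Residual statistics along a column of the covariance matrix\<close>

lemma del_mat_mult_vec: "del_mat L A *v y = del_vec L (A *v del_vec L y)"
  by (auto simp: vec_eq_iff del_mat_def del_vec_def matrix_vector_mult_def intro!: sum.cong)

lemma del_vec_del_vec [simp]: "del_vec L (del_vec L y) = del_vec L y"
  by (simp add: del_vec_def vec_eq_iff)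

lemma del_vec_eq_self: "j \<notin> L \<Longrightarrow> del_vec L (axis j c) = axis j c"
  by (auto simp: del_vec_def vec_eq_iff axis_def)

lemma linear_del_vec: "linear (del_vec L)"
  by (intro linearI) (auto simp: del_vec_def vec_eq_iff)

lemma inner_del_vec: "del_vec L x \<bullet> y = x \<bullet> del_vec L y"
  unfolding inner_vec_def by (intro sum.cong) (auto simp: del_vec_def)

lemma
  assumes "positive_definite A"
  shows del_inv_mult_del_mat: "del_inv L A *v (del_mat L A *v y) = del_vec L y"
    and del_mat_mult_del_inv: "del_mat L A *v (del_inv L A *v y) = del_vec L y"
    and del_vec_del_inv: "del_vec L (del_inv L A *v y) = del_inv L A *v y"
proof -
  have *: "del_mat L (del_inv L A) = del_inv L A" "del_mat L A ** del_inv L A = del_mat L (mat 1)"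
    "del_inv L A ** del_mat L A = del_mat L (mat 1)"
    using theI'[OF del_inv_well_defined[OF assms, of L]] unfolding del_inv_def by blast+
  show "del_inv L A *v (del_mat L A *v y) = del_vec L y"
    "del_mat L A *v (del_inv L A *v y) = del_vec L y"
    by (simp_all add: matrix_vector_mul_assoc *) (simp_all add: del_mat_mult_vec)
  show "del_vec L (del_inv L A *v y) = del_inv L A *v y"
    by (subst (1 2) *(1)[symmetric]) (simp add: del_mat_mult_vec)
qed

text \<open>The numerator of the residual statistic, split off because it is linear in
  \<open>x\<close>.\<close>

definition res_num :: "real^'n^'n \<Rightarrow> 'n list \<Rightarrow> 'n \<Rightarrow> real^'n \<Rightarrow> real" where
  "res_num A ks i x = x $ i - res_col A ks i \<bullet>
     (del_inv (insert i (set ks)) A *v del_vec (insert i (set ks)) x)"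

lemma res_stat_eq: "res_stat A ks i x = res_num A ks i x / sqrt (res_var A ks i)"
  by (simp add: res_stat_def res_num_def)

lemma linear_res_num: "linear (res_num A ks i)"
  by (intro linearI)
     (simp_all add: res_num_def linear_add[OF linear_del_vec] linear_scale[OF linear_del_vec]
        matrix_vector_right_distrib matrix_vector_mult_scaleR inner_add_right algebra_simps)

lemma borel_measurable_res_stat [measurable]: "res_stat A ks i \<in> borel_measurable borel"
proof -
  have "continuous_on UNIV (res_num A ks i)"
    using linear_res_num linear_conv_bounded_linear linear_continuous_on by blast
  from borel_measurable_continuous_onI[OF this] show ?thesis
    unfolding res_stat_eq[abs_def] by measurable
qed

lemma res_num_column_self: "res_num A ks j (column j A) = res_var A ks j"
  by (simp add: res_num_def res_var_def res_col_def column_def)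

lemma positive_definite_sym:
  assumes "positive_definite A"
  shows "A $ i $ j = A $ j $ i"
  using assms unfolding positive_definite_def transpose_def by (metis vec_lambda_beta)

lemma column_eq_mult_axis: "column j A = A *v axis j 1" for A :: "real^'n^'n"
  by (simp add: matrix_vector_mult_basis)

text \<open>The reduced \<open>j\<close>-th column is the reduced matrix applied to
  \<open>axis j 1\<close>, so inverting returns \<open>axis j 1\<close>. What remains is the
  difference of the entries at \<open>(i, j)\<close> and \<open>(j, i)\<close>, which is 0 by
  symmetry.\<close>

lemma res_num_column_other:
  fixes A :: "real^'n^'n"
  assumes A: "positive_definite A" and j: "j \<notin> set ks" "i \<noteq> j"
  shows "res_num A ks i (column j A) = 0"
proof -
  let ?L = "insert i (set ks)"
  have ax: "del_vec ?L (axis j 1) = (axis j 1 :: real^'n)"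
    using j by (intro del_vec_eq_self) auto
  have "del_vec ?L (column j A) = del_mat ?L A *v axis j 1"
    by (simp add: column_eq_mult_axis del_mat_mult_vec ax)
  hence "del_inv ?L A *v del_vec ?L (column j A) = axis j 1"
    using del_inv_mult_del_mat[OF A] ax by simp
  thus ?thesis
    using j positive_definite_sym[OF A, of i j]
    by (simp add: res_num_def res_col_def inner_axis del_vec_def column_def)
qed

text \<open>The residual variance is a Schur complement: it is the quadratic form of
  \<open>A\<close> at \<open>z = axis j 1 - v\<close>, where \<open>v\<close> holds the regression
  coefficients. As \<open>v\<close> has no \<open>j\<close>-th component, \<open>z\<close> is
  nonzero.\<close>

lemma res_var_pos:
  fixes A :: "real^'n^'n"
  assumes A: "positive_definite A"
  shows "0 < res_var A ks j"
proof -
  let ?L = "insert j (set ks)"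
  define c where "c = res_col A ks j"
  define v where "v = del_inv ?L A *v c"
  define z where "z = axis j 1 - v"
  have v: "del_vec ?L v = v" unfolding v_def by (rule del_vec_del_inv[OF A])
  have c: "del_vec ?L c = c" by (simp add: c_def res_col_def)
  have vAv: "v \<bullet> (A *v v) = v \<bullet> c"
  proof -
    have "v \<bullet> (A *v v) = v \<bullet> (del_mat ?L A *v v)"
      by (simp add: del_mat_mult_vec v inner_del_vec[symmetric])
    also have "del_mat ?L A *v v = c"
      unfolding v_def using del_mat_mult_del_inv[OF A] c by simp
    finally show ?thesis .
  qed
  have vA: "v \<bullet> (A *v axis j 1) = v \<bullet> c"
    by (subst (1) v[symmetric]) (simp add: inner_del_vec c_def res_col_def column_eq_mult_axis)
  have Av: "axis j 1 \<bullet> (A *v v) = v \<bullet> (A *v axis j 1)"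
    using A unfolding positive_definite_def by (metis dot_lmul_matrix inner_commute transpose_matrix_vector)
  have jj: "axis j 1 \<bullet> (A *v axis j 1) = A $ j $ j"
    by (simp add: inner_axis' column_eq_mult_axis[symmetric] column_def)
  have "z \<bullet> (A *v z) = A $ j $ j - v \<bullet> c"
    unfolding z_def by (simp add: matrix_vector_mult_diff_distrib inner_diff_left inner_diff_right Av vA vAv jj)
  also have "\<dots> = res_var A ks j"
    by (simp add: res_var_def c_def v_def inner_commute)
  finally have eq: "z \<bullet> (A *v z) = res_var A ks j" .
  have "v $ j = 0" using arg_cong[OF v, of "\<lambda>y. y $ j"] by (simp add: del_vec_def)
  hence "z $ j = 1" by (simp add: z_def)
  hence "z \<noteq> 0" by auto
  thus ?thesis using A eq unfolding positive_definite_def by metis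
qed

lemma res_stat_line_other:
  assumes "positive_definite A" "j \<notin> set ks" "i \<noteq> j"
  shows "res_stat A ks i (x + r *\<^sub>R column j A) = res_stat A ks i x"
  using res_num_column_other[OF assms]
  by (simp add: res_stat_eq linear_add[OF linear_res_num] linear_scale[OF linear_res_num])

lemma res_stat_line_self:
  assumes "positive_definite A"
  shows "res_stat A ks j (x + r *\<^sub>R column j A) = res_stat A ks j x + r * sqrt (res_var A ks j)"
  using res_var_pos[OF assms, of ks j]
  by (simp add: res_stat_eq linear_add[OF linear_res_num] linear_scale[OF linear_res_num]
      res_num_column_self add_divide_distrib real_div_sqrt flip: times_divide_eq_right)


section \<open>Acceptance sections of the step-down procedure\<close>

text \<open>These are the index triples at which strict monotonicity of \<open>h\<close> is assumed;
  elsewhere \<open>h\<close> is arbitrary, so later arguments must stay within them.\<close>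

definition residual_index :: "nat \<Rightarrow> 'n::finite list \<Rightarrow> 'n \<Rightarrow> bool" where
  "residual_index t ks i \<longleftrightarrow> t \<in> {1..CARD('n)} \<and> length ks = t - 1 \<and> distinct ks \<and> i \<notin> set ks"

text \<open>Only ties between two indices other than \<open>j\<close> matter for \<open>\<phi>\<^sub>j\<close>, and excluding just these makes
  \<open>untied A h j\<close> invariant under translations along the \<open>j\<close>-th column of \<open>A\<close>.\<close>

definition untied :: "real^'n^'n \<Rightarrow> (nat \<Rightarrow> 'n \<Rightarrow> 'n list \<Rightarrow> real \<Rightarrow> real) \<Rightarrow> 'n \<Rightarrow> real^'n \<Rightarrow> bool" where
  "untied A h j x \<longleftrightarrow> (\<forall>t ks i k. residual_index t ks i \<and> residual_index t ks k \<and> i \<noteq> k \<and>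
     j \<notin> insert i (insert k (set ks)) \<longrightarrow> gen_stat A h t i ks x \<noteq> gen_stat A h t k ks x)"

locale residual_step_down =
  fixes A :: "real^'n^'n" and h :: "nat \<Rightarrow> 'n \<Rightarrow> 'n list \<Rightarrow> real \<Rightarrow> real"
    and C :: "nat \<Rightarrow> real" and J :: "nat \<Rightarrow> real^'n \<Rightarrow> 'n"
  assumes A: "positive_definite A"
    and h: "residual_index t ks i \<Longrightarrow> strict_mono_on {0..} (h t i ks)"
    and J: "argmax_selection A h J"
begin

lemma earlier_Suc: "1 \<le> t \<Longrightarrow> earlier J (Suc t) x = earlier J t x @ [J t x]"
  by (simp add: earlier_def)

lemma
  assumes "t \<in> {1..CARD('n)}"
  shows J_measurable: "J t \<in> measurable borel (count_space UNIV)"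
    and J_notin: "J t x \<notin> set (earlier J t x)"
    and J_max: "k \<notin> set (earlier J t x) \<Longrightarrow>
      gen_stat A h t k (earlier J t x) x \<le> gen_stat A h t (J t x) (earlier J t x) x"
proof -
  have sel: "J t \<in> measurable borel (count_space UNIV)"
    "is_arg_max (\<lambda>j. gen_stat A h t j (earlier J t x) x) (\<lambda>j. j \<notin> set (earlier J t x)) (J t x)"
    using J assms unfolding argmax_selection_def by blast+
  thus "J t \<in> measurable borel (count_space UNIV)" "J t x \<notin> set (earlier J t x)"
    "k \<notin> set (earlier J t x) \<Longrightarrow>
      gen_stat A h t k (earlier J t x) x \<le> gen_stat A h t (J t x) (earlier J t x) x"
    by (auto simp: is_arg_max_linorder)
qed

lemma distinct_earlier: "t \<le> CARD('n) \<Longrightarrow> distinct (earlier J t x)"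
proof (induction t)
  case (Suc t)
  show ?case
  proof (cases "t = 0")
    case False
    thus ?thesis using Suc J_notin[of t x] by (simp add: earlier_Suc)
  qed (simp add: earlier_def)
qed (simp add: earlier_def)

lemma length_earlier [simp]: "length (earlier J t x) = t - 1"
  by (simp add: earlier_def)

lemma set_earlier: "set (earlier J t x) = (\<lambda>s. J s x) ` {1..<t}"
  by (simp add: earlier_def)

lemma residual_index_J: "t \<in> {1..CARD('n)} \<Longrightarrow> residual_index t (earlier J t x) (J t x)"
  unfolding residual_index_def using J_notin distinct_earlier by simp

lemma earlier_measurable:
  "t \<le> CARD('n) \<Longrightarrow> (\<lambda>x. earlier J t x) \<in> measurable borel (count_space UNIV)"
proof (induction t)
  case 0
  thus ?case by (simp add: earlier_def)
next
  case (Suc t)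
  show ?case
  proof (cases "t = 0")
    case True
    thus ?thesis by (simp add: earlier_def)
  next
    case False
    have "(\<lambda>x. earlier J t x @ [J t x]) \<in> measurable borel (count_space UNIV)"
    proof (rule measurable_compose_countable[where g = "\<lambda>x. earlier J t x"])
      show "(\<lambda>x. earlier J t x) \<in> measurable borel (count_space UNIV)" using Suc by simp
      show "(\<lambda>x. ks @ [J t x]) \<in> measurable borel (count_space UNIV)" for ks
        using Suc.prems False by (intro measurable_compose[OF J_measurable]) auto
    qed
    thus ?thesis using False by (simp add: earlier_Suc)
  qed
qed

section \<open>Measurability of the statistics and of the procedure\<close>

lemma borel_measurable_gen_stat:
  assumes "residual_index t ks i"
  shows "gen_stat A h t i ks \<in> borel_measurable borel"
proof -
  \<comment> \<open>\<open>h\<close> is controlled on \<open>{0..}\<close> only; composing with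
    \<open>max 0\<close> gives a function monotone on the whole line, hence Borel, without changing
    its value at absolute values.\<close>
  have "mono (\<lambda>u. h t i ks (max 0 u))"
    using strict_mono_on_imp_mono_on[OF h[OF assms]] by (auto simp: mono_def mono_on_def)
  hence [measurable]: "(\<lambda>u. h t i ks (max 0 u)) \<in> borel_measurable borel"
    by (rule borel_measurable_mono)
  have eq: "gen_stat A h t i ks = (\<lambda>u. h t i ks (max 0 u)) \<circ> (\<lambda>x. \<bar>res_stat A ks i x\<bar>)"
    by (simp add: gen_stat_def fun_eq_iff)
  show ?thesis unfolding eq comp_def by measurable
qed

lemma passes_measurable:
  assumes t: "t \<in> {1..CARD('n)}"
  shows "Measurable.pred borel (passes A h C J t)"
proof -
  have "Measurable.pred borel (\<lambda>x. residual_index t ks i \<and> gen_stat A h t i ks x > C t)" for ks i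
    using borel_measurable_gen_stat[of t ks i] by (cases "residual_index t ks i") auto
  hence "Measurable.pred borel (\<lambda>x. residual_index t ks (J t x) \<and> gen_stat A h t (J t x) ks x > C t)" for ks
    using J_measurable[OF t] by (rule measurable_compose_countable)
  hence "Measurable.pred borel (\<lambda>x. residual_index t (earlier J t x) (J t x) \<and>
      gen_stat A h t (J t x) (earlier J t x) x > C t)"
    by (rule measurable_compose_countable) (use t earlier_measurable in auto)
  thus ?thesis using residual_index_J[OF t] by (simp add: passes_def[abs_def])
qed

lemma step_down_measurable [measurable]: "step_down A h C J j \<in> borel_measurable borel"
proof -
  have "Measurable.pred borel (\<lambda>x. \<exists>t\<in>{1..CARD('n)}. (\<forall>s\<in>{1..t}. passes A h C J s x) \<and> J t x = j)"
  proof (intro pred_intros_finite pred_intros_logic)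
    fix t assume t: "t \<in> {1..CARD('n)}"
    show "Measurable.pred borel (\<lambda>x. J t x = j)"
      using measurable_compose[OF J_measurable[OF t], of "\<lambda>i. i = j" "count_space UNIV"] by simp
    show "Measurable.pred borel (\<lambda>x. passes A h C J s x)" if "s \<in> {1..t}" for s
      using passes_measurable[of s] t that by auto
  qed auto
  thus ?thesis unfolding step_down_def[abs_def] by measurable
qed

lemma step_down_eq_1_iff: "step_down A h C J j x = 1 \<longleftrightarrow>
    (\<exists>t\<in>{1..CARD('n)}. (\<forall>s\<in>{1..t}. passes A h C J s x) \<and> J t x = j)"
  by (simp add: step_down_def)

section \<open>Ties and rejections along a column of the covariance matrix\<close>

lemma gen_stat_line_other:
  assumes "j \<notin> set ks" "i \<noteq> j"
  shows "gen_stat A h t i ks (x + r *\<^sub>R column j A) = gen_stat A h t i ks x"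
  using res_stat_line_other[OF A assms] by (simp add: gen_stat_def)

lemma untied_line: "untied A h j x \<Longrightarrow> untied A h j (x + r *\<^sub>R column j A)"
  unfolding untied_def using gen_stat_line_other by (metis insert_iff)

text \<open>There are countably many index tuples, so each tie can be excluded separately; it meets
  every line along the \<open>i\<close>-th column in a finite set and is null by the
  disintegration.\<close>

lemma AE_untied: "AE x in lborel. untied A h j x"
proof -
  have "AE x in lborel. gen_stat A h t i ks x \<noteq> gen_stat A h t k ks x"
    if i: "residual_index t ks i" and k: "residual_index t ks k" and ik: "i \<noteq> k" for t ks i k
  proof -
    define g where "g = column i A"
    have "0 < A $ i $ i"
      using A[unfolded positive_definite_def] matrix_vector_mult_basis[of A i]
      by (metis axis_eq_0_iff column_def inner_axis' mult_1 vec_lambda_beta zero_neq_one inner_real_def)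
    hence "g $ i \<noteq> 0" by (simp add: g_def column_def)
    hence "g \<noteq> 0" by auto
    hence ag: "(g /\<^sub>R (g \<bullet> g)) \<bullet> g = 1" by auto
    have [measurable]: "gen_stat A h t i ks \<in> borel_measurable borel" "gen_stat A h t k ks \<in> borel_measurable borel"
      using i k borel_measurable_gen_stat by auto
    \<comment> \<open>On lines along the \<open>i\<close>-th column the statistic of \<open>k\<close> is constant, while that of \<open>i\<close> takes each
      value at most twice.\<close>
    have "AE r in lborel. gen_stat A h t i ks (x + r *\<^sub>R g) \<noteq> gen_stat A h t k ks (x + r *\<^sub>R g)" for x
    proof -
      let ?U = "res_stat A ks i x" and ?s = "sqrt (res_var A ks i)"
      have s: "?s > 0" using res_var_pos[OF A] by simp
      let ?E = "{r. h t i ks \<bar>?U + r * ?s\<bar> = gen_stat A h t k ks x}"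
      have "finite ?E"
      proof (cases "?E = {}")
        case False
        then obtain r0 where r0: "r0 \<in> ?E" by blast
        \<comment> \<open>Injectivity of \<open>h\<close> on \<open>{0..}\<close> leaves only
          \<open>r0\<close> and its reflection in the zero of \<open>?U + r * ?s\<close>.\<close>
        have "r \<in> {r0, - (2 * ?U / ?s) - r0}" if "r \<in> ?E" for r
        proof -
          have "h t i ks \<bar>?U + r * ?s\<bar> = h t i ks \<bar>?U + r0 * ?s\<bar>" using r0 that by simp
          hence "\<bar>?U + r * ?s\<bar> = \<bar>?U + r0 * ?s\<bar>"
            by (rule inj_onD[OF strict_mono_on_imp_inj_on[OF h[OF i]]]) simp_all
          hence "(r - r0) * ?s = 0 \<or> (r + r0) * ?s + 2 * ?U = 0"
            by (auto simp: abs_eq_iff algebra_simps)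
          thus ?thesis using s by (auto simp: field_simps)
        qed
        hence "?E \<subseteq> {r0, - (2 * ?U / ?s) - r0}" by blast
        thus ?thesis by (rule finite_subset) simp
      qed auto
      hence "AE r in lborel. r \<notin> ?E" by (intro AE_not_in finite_imp_null_set_lborel)
      moreover have "gen_stat A h t i ks (x + r *\<^sub>R g) = h t i ks \<bar>?U + r * ?s\<bar>" for r
        by (simp add: gen_stat_def g_def res_stat_line_self[OF A])
      moreover have "gen_stat A h t k ks (x + r *\<^sub>R g) = gen_stat A h t k ks x" for r
        unfolding g_def using i ik by (intro gen_stat_line_other) (auto simp: residual_index_def)
      ultimately show ?thesis by simp
    qed
    thus ?thesis by (subst AE_lborel_iff_AE_lines[OF ag]) auto
  qed
  hence "AE x in lborel. residual_index t ks i \<and> residual_index t ks k \<and> i \<noteq> k \<and>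
     j \<notin> insert i (insert k (set ks)) \<longrightarrow> gen_stat A h t i ks x \<noteq> gen_stat A h t k ks x" for t ks i k
    by (cases "residual_index t ks i \<and> residual_index t ks k \<and> i \<noteq> k") auto
  thus ?thesis unfolding untied_def by (intro AE_all_countable[THEN iffD2] allI)
qed

text \<open>Up to stage \<open>t\<close> the translation along the \<open>j\<close>-th column of \<open>A\<close> only changes the statistics of \<open>j\<close>:
  either \<open>j\<close> overtakes the old maximiser, which had already passed, at an earlier stage, or all
  earlier selections are unchanged and \<open>j\<close> is selected at stage \<open>t\<close> again.\<close>

lemma rejection_persists:
  assumes x: "untied A h j x" and t: "t \<in> {1..CARD('n)}" "\<And>s. s \<in> {1..t} \<Longrightarrow> passes A h C J s x" "J t x = j"
    and y: "y = x + r *\<^sub>R column j A"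
    and incr: "\<bar>res_stat A (earlier J t x) j x\<bar> < \<bar>res_stat A (earlier J t x) j y\<bar>"
  shows "step_down A h C J j y = 1"
proof (rule ccontr)
  assume "step_down A h C J j y \<noteq> 1"
  hence nrej: "\<not> (\<forall>s\<in>{1..u}. passes A h C J s y)" if "u \<in> {1..CARD('n)}" "J u y = j" for u
    using that step_down_eq_1_iff by metis
  have j: "j \<notin> set (earlier J s x)" if "s \<le> t" for s
    using J_notin[OF t(1), of x] t(3) that by (auto simp: set_earlier)
  have same: "gen_stat A h s i (earlier J s x) y = gen_stat A h s i (earlier J s x) x" if "s \<le> t" "i \<noteq> j" for s i
    unfolding y using j that by (intro gen_stat_line_other) auto
  have eq: "earlier J s y = earlier J s x" if "\<forall>u\<in>{1..<s}. J u y = J u x" for s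
    using that by (simp add: earlier_def)
  have "\<forall>u\<in>{1..<s}. J u y = J u x \<and> passes A h C J u y" if "s \<le> t" for s
    using that
  proof (induction s)
    case (Suc s)
    show ?case
    proof (cases "s = 0")
      case False
      hence s: "s \<in> {1..CARD('n)}" "s < t" "s \<in> {1..t}" using Suc.prems t(1) by auto
      have IH: "\<forall>u\<in>{1..<s}. J u y = J u x \<and> passes A h C J u y" using Suc by simp
      hence e: "earlier J s y = earlier J s x" by (intro eq) auto
      have Jx: "J s x \<noteq> j" using j[of t] s False by (auto simp: set_earlier)
      \<comment> \<open>The old maximiser is not \<open>j\<close>, so its statistic is unchanged at
        \<open>y\<close> and bounds the new maximum from below. The stage is therefore passed at
        \<open>y\<close> whichever index is selected.\<close>
      have max: "gen_stat A h s (J s x) (earlier J s x) x \<le> gen_stat A h s (J s y) (earlier J s x) y"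
        using J_max[OF s(1), of "J s x" y] J_notin[OF s(1), of x] same[of s "J s x"] s Jx e by simp
      hence pass: "passes A h C J s y"
        using t(2)[OF s(3)] unfolding passes_def e by simp
      have "J s y = J s x"
      proof (cases "J s y = j")
        case True
        \<comment> \<open>Here \<open>j\<close> has overtaken: all stages up to \<open>s\<close>
          pass, so \<open>j\<close> would be rejected at \<open>y\<close>.\<close>
        have "\<forall>u\<in>{1..s}. passes A h C J u y" using IH pass by (auto simp: le_less)
        thus ?thesis using nrej[OF s(1) True] by blast
      next
        case False
        \<comment> \<open>Neither selected index is \<open>j\<close>, so both statistics are
          unchanged. Each is maximal at its own point, so they are equal, and \<open>untied\<close>
          makes the indices equal.\<close>
        hence "gen_stat A h s (J s x) (earlier J s x) x = gen_stat A h s (J s y) (earlier J s x) x"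
          using max same[of s "J s y"] s J_max[OF s(1), of "J s y" x] J_notin[OF s(1), of y] e by simp
        thus ?thesis
          using x residual_index_J[OF s(1), of x] residual_index_J[OF s(1), of y] j[of s] s False Jx
          unfolding untied_def e by (metis insert_iff less_imp_le)
      qed
      thus ?thesis using IH pass by (auto simp: less_Suc_eq)
    qed simp
  qed simp
  from this[of t] have prev: "\<forall>u\<in>{1..<t}. J u y = J u x \<and> passes A h C J u y" by simp
  hence e: "earlier J t y = earlier J t x" by (intro eq) auto
  have lt: "gen_stat A h t j (earlier J t x) x < gen_stat A h t j (earlier J t x) y"
    unfolding gen_stat_def using residual_index_J[OF t(1), of x] t(3) incr
    by (intro strict_mono_onD[OF h]) auto
  have "J t y = j"
  proof (rule ccontr)
    assume ne: "J t y \<noteq> j"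
    \<comment> \<open>The unchanged statistic of a rival would be at most that of \<open>j\<close>
      at \<open>x\<close> and at least the strictly larger one at \<open>y\<close>.\<close>
    have "gen_stat A h t (J t y) (earlier J t x) x \<le> gen_stat A h t j (earlier J t x) x"
      using J_max[OF t(1), of "J t y" x] J_notin[OF t(1), of y] e t(3) by simp
    moreover have "gen_stat A h t j (earlier J t x) y \<le> gen_stat A h t (J t y) (earlier J t x) y"
      using J_max[OF t(1), of j y] j[of t] e by simp
    ultimately show False using lt same[of t "J t y"] ne by simp
  qed
  moreover have "passes A h C J t y"
    using t(2)[of t] t(1,3) lt \<open>J t y = j\<close> unfolding passes_def e by simp
  hence "\<forall>u\<in>{1..t}. passes A h C J u y" using prev by (auto simp: le_less)
  ultimately show False using nrej t(1) by blast
qed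

text \<open>At the stage where \<open>j\<close> is rejected at an inner point, its residual
  statistic is affine in \<open>r\<close> with positive slope. The absolute value therefore grows
  strictly towards at least one end point, to which the rejection persists.\<close>

lemma convex_acceptance_section:
  assumes x: "untied A h j x"
  shows "convex {r. step_down A h C J j (x + r *\<^sub>R column j A) = 0}"
proof -
  let ?y = "\<lambda>r. x + r *\<^sub>R column j A"
  have "step_down A h C J j (?y r2) = 0"
    if acc: "step_down A h C J j (?y r1) = 0" "step_down A h C J j (?y r3) = 0" and r: "r1 \<le> r2" "r2 \<le> r3"
    for r1 r2 r3
  proof (rule ccontr)
    assume "step_down A h C J j (?y r2) \<noteq> 0"
    hence rej: "step_down A h C J j (?y r2) = 1" by (simp add: step_down_def split: if_splits)
    then obtain t where t: "t \<in> {1..CARD('n)}" "\<And>s. s \<in> {1..t} \<Longrightarrow> passes A h C J s (?y r2)" "J t (?y r2) = j"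
      unfolding step_down_eq_1_iff by blast
    define ks where "ks = earlier J t (?y r2)"
    have y: "?y r = ?y r2 + (r - r2) *\<^sub>R column j A" for r by (simp add: algebra_simps)
    have s: "0 < sqrt (res_var A ks j)" using res_var_pos[OF A] by simp
    have U: "res_stat A ks j (?y r) = res_stat A ks j (?y r2) + (r - r2) * sqrt (res_var A ks j)" for r
      by (subst y) (rule res_stat_line_self[OF A])
    have ne: "r2 < r3" "r1 < r2" using acc rej r by (force simp: le_less)+
    have "0 < (r3 - r2) * sqrt (res_var A ks j)" "(r1 - r2) * sqrt (res_var A ks j) < 0"
      using s ne by (simp_all add: mult_neg_pos)
    hence "\<bar>res_stat A ks j (?y r2)\<bar> < \<bar>res_stat A ks j (?y r3)\<bar> \<or>
        \<bar>res_stat A ks j (?y r2)\<bar> < \<bar>res_stat A ks j (?y r1)\<bar>"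
      unfolding U[of r3] U[of r1] by linarith
    thus False
      using rejection_persists[OF untied_line[OF x] t y] acc unfolding ks_def by fastforce
  qed
  thus ?thesis unfolding is_interval_convex_1[symmetric] is_interval_1 by blast
qed

end


section \<open>Gaussian risks\<close>

text \<open>Completing the square yields a multiple of the normal density with mean
  \<open>b / c\<close> and variance \<open>1 / c\<close>.\<close>

lemma integrable_exp_quadratic:
  fixes b c :: real
  assumes "0 < c"
  shows "integrable lborel (\<lambda>x. exp (b * x - c * x\<^sup>2 / 2))"
proof -
  have "integrable lborel (\<lambda>x. exp (b\<^sup>2 / (2 * c)) * sqrt (2 * pi / c) * normal_density (b / c) (1 / sqrt c) x)"
    by (intro integrable_mult_right integrable_normal_density) (use assms in auto)
  also have "(\<lambda>x. exp (b\<^sup>2 / (2 * c)) * sqrt (2 * pi / c) * normal_density (b / c) (1 / sqrt c) x) =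
      (\<lambda>x. exp (b * x - c * x\<^sup>2 / 2))"
  proof
    fix x
    have "b\<^sup>2 / (2 * c) + - (x - b / c)\<^sup>2 / (2 * (1 / sqrt c)\<^sup>2) = b * x - c * x\<^sup>2 / 2"
      using assms by (simp add: power_divide field_simps power2_eq_square)
    thus "exp (b\<^sup>2 / (2 * c)) * sqrt (2 * pi / c) * normal_density (b / c) (1 / sqrt c) x =
        exp (b * x - c * x\<^sup>2 / 2)"
      using assms by (simp add: normal_density_def power_divide exp_add[symmetric])
  qed
  finally show ?thesis .
qed

lemma integrable_exp_inner_minus_norm:
  fixes \<eta> :: "'a::euclidean_space"
  assumes "0 < c"
  shows "integrable lborel (\<lambda>x. exp (\<eta> \<bullet> x - c * (x \<bullet> x) / 2))"
proof (rule integrableI_bounded)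
  let ?f = "\<lambda>i x :: real. exp ((\<eta> \<bullet> i) * x - c * x\<^sup>2 / 2)"
  have "exp (\<eta> \<bullet> x - c * (x \<bullet> x) / 2) = (\<Prod>i\<in>Basis. ?f i (x \<bullet> i))" for x
    unfolding exp_sum[OF finite_Basis, symmetric] euclidean_inner[of \<eta> x] euclidean_inner[of x x]
    by (simp add: sum_subtractf sum_distrib_left sum_divide_distrib power2_eq_square)
  hence "(\<integral>\<^sup>+x. ennreal (norm (exp (\<eta> \<bullet> x - c * (x \<bullet> x) / 2))) \<partial>lborel) =
      (\<integral>\<^sup>+x. (\<Prod>i\<in>Basis. ennreal (?f i (x \<bullet> i))) \<partial>lborel)"
    by (simp add: prod_ennreal abs_prod)
  also have "\<dots> = (\<Prod>i\<in>Basis. \<integral>\<^sup>+x. ennreal (?f i x) \<partial>lborel)"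
    by (rule nn_integral_lborel_prod) auto
  also have "\<dots> < \<infinity>"
  proof -
    have "(\<integral>\<^sup>+x. ennreal (?f i x) \<partial>lborel) < \<top>" for i
      using integrable_exp_quadratic[OF assms, of "\<eta> \<bullet> i"]
      by (simp add: real_integrable_def less_top)
    thus ?thesis by (simp add: ennreal_prod_eq_top less_top[symmetric])
  qed
  finally show "(\<integral>\<^sup>+x. ennreal (norm (exp (\<eta> \<bullet> x - c * (x \<bullet> x) / 2))) \<partial>lborel) < \<infinity>" .
qed measurable

text \<open>The constant is the minimum of the quadratic form on the compact unit sphere;
  homogeneity extends the bound to all vectors.\<close>

lemma positive_definite_lower_bound:
  fixes P :: "real^'n^'n"
  assumes "positive_definite P"
  obtains c where "0 < c" "\<And>x. c * (x \<bullet> x) \<le> x \<bullet> (P *v x)"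
proof -
  let ?S = "sphere (0 :: real^'n) 1"
  have "continuous_on ?S (\<lambda>x. x \<bullet> (P *v x))"
    by (intro continuous_intros linear_continuous_on) (simp add: linear_linear)
  moreover have "axis undefined 1 \<in> ?S" by simp
  ultimately obtain z where z: "z \<in> ?S" "\<And>y. y \<in> ?S \<Longrightarrow> z \<bullet> (P *v z) \<le> y \<bullet> (P *v y)"
    using continuous_attains_inf[of ?S "\<lambda>x. x \<bullet> (P *v x)"] by auto
  show ?thesis
  proof (rule that)
    have "z \<noteq> 0" using z(1) by auto
    thus "0 < z \<bullet> (P *v z)" using assms unfolding positive_definite_def by blast
    show "z \<bullet> (P *v z) * (x \<bullet> x) \<le> x \<bullet> (P *v x)" for x
    proof (cases "x = 0")
      case False
      have "z \<bullet> (P *v z) \<le> (x /\<^sub>R norm x) \<bullet> (P *v (x /\<^sub>R norm x))"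
        using False by (intro z(2)) simp
      also have "\<dots> = x \<bullet> (P *v x) / (x \<bullet> x)"
        by (simp add: matrix_vector_mult_scaleR power2_norm_eq_inner[symmetric] power2_eq_square field_simps)
      finally show ?thesis using False by (simp add: pos_le_divide_eq)
    qed simp
  qed
qed

lemma borel_measurable_mult_vec [measurable]: "(\<lambda>x. (P :: real^'n^'m) *v x) \<in> borel_measurable borel"
  by (intro borel_measurable_continuous_onI linear_continuous_on) (simp add: linear_linear)

lemma integrable_gaussian_weight:
  fixes P :: "real^'n^'n"
  assumes "positive_definite P"
  shows "integrable lborel (\<lambda>x. exp (- (x \<bullet> (P *v x)) / 2) * exp (\<eta> \<bullet> x))"
proof -
  obtain c where c: "0 < c" "\<And>x. c * (x \<bullet> x) \<le> x \<bullet> (P *v x)"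
    using positive_definite_lower_bound[OF assms] by blast
  show ?thesis
  proof (rule Bochner_Integration.integrable_bound[OF integrable_exp_inner_minus_norm[OF c(1)]])
    show "AE x in lborel. norm (exp (- (x \<bullet> (P *v x)) / 2) * exp (\<eta> \<bullet> x)) \<le> norm (exp (\<eta> \<bullet> x - c * (x \<bullet> x) / 2))"
      using c(2) by (intro AE_I2) (simp add: exp_add[symmetric])
  qed measurable
qed

section \<open>Exponential-family form of the normal density and the risk\<close>

lemma
  fixes A :: "real^'n^'n"
  assumes A: "positive_definite A"
  shows positive_definite_matrix_inv_left: "matrix_inv A ** A = mat 1"
    and positive_definite_matrix_inv_right: "A ** matrix_inv A = mat 1"
    and positive_definite_matrix_inv: "positive_definite (matrix_inv A)"
proof -
  have "x = 0" if "A *v x = 0" for x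
    using A that unfolding positive_definite_def by (metis inner_zero_right less_irrefl)
  then obtain B where "B ** A = mat 1" using matrix_left_invertible_ker[of A] by blast
  hence "\<exists>B. A ** B = mat 1 \<and> B ** A = mat 1" using matrix_left_right_inverse by blast
  from someI_ex[OF this] show inv: "matrix_inv A ** A = mat 1" "A ** matrix_inv A = mat 1"
    unfolding matrix_inv_def by simp_all
  have tr: "transpose A = A" using A by (simp add: positive_definite_def)
  have "A ** transpose (matrix_inv A) = mat 1"
    using arg_cong[OF inv(1), of transpose] by (simp add: matrix_transpose_mul tr)
  hence "matrix_inv A ** (A ** transpose (matrix_inv A)) = matrix_inv A" by simp
  hence "transpose (matrix_inv A) = matrix_inv A" by (simp add: matrix_mul_assoc inv)
  moreover have "0 < x \<bullet> (matrix_inv A *v x)" if "x \<noteq> 0" for x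
  proof -
    define y where "y = matrix_inv A *v x"
    have x: "x = A *v y" by (simp add: y_def matrix_vector_mul_assoc inv)
    hence "y \<noteq> 0" using that by auto
    hence "0 < y \<bullet> (A *v y)" using A unfolding positive_definite_def by blast
    thus ?thesis unfolding y_def[symmetric] x[symmetric] by (simp add: inner_commute)
  qed
  ultimately show "positive_definite (matrix_inv A)" by (simp add: positive_definite_def)
qed

lemma positive_definite_inner_commute:
  assumes "positive_definite P"
  shows "x \<bullet> (P *v y) = (P *v x) \<bullet> y"
  using assms unfolding positive_definite_def by (metis dot_lmul_matrix transpose_matrix_vector)

text \<open>Expanding the quadratic form separates a factor depending only on \<theta>, a weight
  depending only on \<open>x\<close>, and an exponential with natural parameter
  \<open>matrix_inv A *v \<theta>\<close>.\<close>

lemma mvn_density_exponential_family: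
  fixes A :: "real^'n^'n"
  assumes "positive_definite A"
  shows "mvn_density \<theta> A x = exp (- (\<theta> \<bullet> (matrix_inv A *v \<theta>)) / 2) / sqrt ((2 * pi) ^ CARD('n) * det A) *
    (exp (- (x \<bullet> (matrix_inv A *v x)) / 2) * exp ((matrix_inv A *v \<theta>) \<bullet> x))"
proof -
  let ?P = "matrix_inv A"
  have "(x - \<theta>) \<bullet> (?P *v (x - \<theta>)) = x \<bullet> (?P *v x) - 2 * ((?P *v \<theta>) \<bullet> x) + \<theta> \<bullet> (?P *v \<theta>)"
    using positive_definite_inner_commute[OF positive_definite_matrix_inv[OF assms], of \<theta> x]
    by (simp add: matrix_vector_mult_diff_distrib inner_diff_left inner_diff_right inner_commute)
  hence "- ((x - \<theta>) \<bullet> (?P *v (x - \<theta>))) / 2 =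
      - (\<theta> \<bullet> (?P *v \<theta>)) / 2 + (- (x \<bullet> (?P *v x)) / 2 + (?P *v \<theta>) \<bullet> x)"
    by (simp add: field_simps)
  hence "exp (- ((x - \<theta>) \<bullet> (?P *v (x - \<theta>))) / 2) =
      exp (- (\<theta> \<bullet> (?P *v \<theta>)) / 2) * (exp (- (x \<bullet> (?P *v x)) / 2) * exp ((?P *v \<theta>) \<bullet> x))"
    by (simp only: exp_add)
  thus ?thesis unfolding mvn_density_def by (simp only: times_divide_eq_left)
qed

text \<open>Treating \<open>det A \<le> 0\<close> separately, where \<^const>\<open>mvn\<close> is the zero measure, avoids proving that a
  positive definite matrix has positive determinant.\<close>

lemma risk_degenerate:
  fixes A :: "real^'n^'n"
  assumes "det A \<le> 0"
  shows "risk A j \<phi> \<theta> = 0"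
proof -
  have "sqrt ((2 * pi) ^ CARD('n) * det A) \<le> 0"
    using assms by (simp add: mult_nonneg_nonpos)
  hence "ennreal (mvn_density \<theta> A x) = 0" for x
    unfolding mvn_density_def by (simp add: ennreal_eq_0_iff divide_le_0_iff)
  hence mvn: "mvn \<theta> A = density lborel (\<lambda>_. 0)" by (simp add: mvn_def)
  have "AE x in mvn \<theta> A. loss j (\<phi> x) \<theta> = 0" unfolding mvn by (subst AE_density) auto
  thus ?thesis unfolding risk_def by (rule integral_eq_zero_AE)
qed

lemma risk_eq:
  fixes A :: "real^'n^'n"
  assumes A: "positive_definite A" and det: "0 < det A" and [measurable]: "\<phi> \<in> borel_measurable borel"
  shows "risk A j \<phi> \<theta> =
    exp (- (\<theta> \<bullet> (matrix_inv A *v \<theta>)) / 2) / sqrt ((2 * pi) ^ CARD('n) * det A) *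
      (\<integral>x. loss j (\<phi> x) \<theta> * (exp (- (x \<bullet> (matrix_inv A *v x)) / 2) * exp ((matrix_inv A *v \<theta>) \<bullet> x)) \<partial>lborel)"
proof -
  let ?k = "exp (- (\<theta> \<bullet> (matrix_inv A *v \<theta>)) / 2) / sqrt ((2 * pi) ^ CARD('n) * det A)"
  have k: "0 < ?k" using det by simp
  let ?d = "\<lambda>x. exp (- (x \<bullet> (matrix_inv A *v x)) / 2) * exp ((matrix_inv A *v \<theta>) \<bullet> x)"
  have "risk A j \<phi> \<theta> = (\<integral>x. loss j (\<phi> x) \<theta> \<partial>density lborel (\<lambda>x. ennreal (?k * ?d x)))"
    by (simp only: risk_def mvn_def mvn_density_exponential_family[OF A])
  also have "\<dots> = (\<integral>x. (?k * ?d x) *\<^sub>R loss j (\<phi> x) \<theta> \<partial>lborel)"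
  proof (rule integral_density)
    show "AE x in lborel. 0 \<le> ?k * ?d x"
      using k by (intro AE_I2 mult_nonneg_nonneg) auto
  qed (unfold loss_def, measurable)
  also have "\<dots> = (\<integral>x. ?k * (loss j (\<phi> x) \<theta> * ?d x) \<partial>lborel)"
    by (intro Bochner_Integration.integral_cong) auto
  also have "\<dots> = ?k * (\<integral>x. loss j (\<phi> x) \<theta> * ?d x \<partial>lborel)" by simp
  finally show ?thesis .
qed

section \<open>Admissibility of the step-down procedure\<close>

theorem theorem3p1:
  fixes \<Sigma> :: "real^'n^'n"
    and h :: "nat \<Rightarrow> 'n \<Rightarrow> 'n list \<Rightarrow> real \<Rightarrow> real"
    and C :: "nat \<Rightarrow> real"
    and J :: "nat \<Rightarrow> real^'n \<Rightarrow> 'n"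
  assumes "positive_definite \<Sigma>"
    and "\<And>t j ks. t \<in> {1..CARD('n)} \<Longrightarrow> length ks = t - 1 \<Longrightarrow> distinct ks \<Longrightarrow> j \<notin> set ks \<Longrightarrow>
           strict_mono_on {0..} (h t j ks)"
    and "\<And>s t. 1 \<le> s \<Longrightarrow> s \<le> t \<Longrightarrow> t \<le> CARD('n) \<Longrightarrow> C t \<le> C s"
    and "C CARD('n) > 0"
    and "argmax_selection \<Sigma> h J"
  shows "admissible \<Sigma> (step_down \<Sigma> h C J)"
proof -
  interpret residual_step_down \<Sigma> h C J
    using assms by unfold_locales (auto simp: residual_index_def)
  let ?\<Phi> = "step_down \<Sigma> h C J" and ?P = "matrix_inv \<Sigma>"
  let ?w = "\<lambda>x. exp (- (x \<bullet> (?P *v x)) / 2)"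
  note P = positive_definite_matrix_inv[OF A] and inv = positive_definite_matrix_inv_left[OF A] positive_definite_matrix_inv_right[OF A]
  have test: "multiple_test ?\<Phi>"
    unfolding multiple_test_def by (simp add: step_down_def)
  \<comment> \<open>Any competitor that is nowhere worse has identical risks, so strict improvement
    is impossible. Each index is treated on its own.\<close>
  have same_risk: "risk \<Sigma> j (\<Phi>' j) \<theta> = risk \<Sigma> j (?\<Phi> j) \<theta>"
    if \<Phi>': "multiple_test \<Phi>'" and le: "\<And>j \<theta>. risk \<Sigma> j (\<Phi>' j) \<theta> \<le> risk \<Sigma> j (?\<Phi> j) \<theta>" for \<Phi>' j \<theta>
  proof (cases "det \<Sigma> \<le> 0")
    case True
    thus ?thesis by (simp add: risk_degenerate)
  next
    case False
    hence det: "0 < det \<Sigma>" by simp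
    have meas [measurable]: "\<Phi>' j \<in> borel_measurable borel" and bnd: "\<And>x. 0 \<le> \<Phi>' j x" "\<And>x. \<Phi>' j x \<le> 1"
      using \<Phi>' by (auto simp: multiple_test_def)
    define k where "k \<theta> = exp (- (\<theta> \<bullet> (?P *v \<theta>)) / 2) / sqrt ((2 * pi) ^ CARD('n) * det \<Sigma>)" for \<theta>
    have k_pos: "0 < k \<theta>" for \<theta> using det by (simp add: k_def)
    have risk: "risk \<Sigma> j \<phi> \<theta> = k \<theta> * (\<integral>x. loss j (\<phi> x) \<theta> * (?w x * exp ((?P *v \<theta>) \<bullet> x)) \<partial>lborel)"
      if "\<phi> \<in> borel_measurable borel" for \<phi> \<theta>
      unfolding k_def by (rule risk_eq[OF A det that])
    have wint: "integrable lborel (\<lambda>x. ?w x * exp (\<eta> \<bullet> x))" for \<eta>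
      by (rule integrable_gaussian_weight[OF P])
    have int: "integrable lborel (\<lambda>x. \<phi> x * (?w x * exp (\<eta> \<bullet> x)))"
      if [measurable]: "\<phi> \<in> borel_measurable borel" and "\<And>x. 0 \<le> \<phi> x" "\<And>x. \<phi> x \<le> 1" for \<phi> \<eta>
      by (rule Bochner_Integration.integrable_bound[OF wint[of \<eta>]])
         (use that in \<open>auto simp: abs_mult intro!: mult_left_le_one_le\<close>)
    have \<Phi>01: "0 \<le> ?\<Phi> j x" "?\<Phi> j x \<le> 1" for x by (simp_all add: step_down_def)
    \<comment> \<open>Every \<eta> is the natural parameter of the mean
      \<open>\<Sigma> *v \<eta>\<close>, and the positive factor \<open>k\<close> cancels from the
      risk comparison.\<close>
    have le': "(\<integral>x. loss j (\<Phi>' j x) (\<Sigma> *v \<eta>) * (?w x * exp (\<eta> \<bullet> x)) \<partial>lborel) \<le>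
        (\<integral>x. loss j (?\<Phi> j x) (\<Sigma> *v \<eta>) * (?w x * exp (\<eta> \<bullet> x)) \<partial>lborel)" for \<eta>
    proof -
      have "?P *v (\<Sigma> *v \<eta>) = \<eta>" by (simp add: matrix_vector_mul_assoc inv)
      thus ?thesis
        using le[of j "\<Sigma> *v \<eta>"] k_pos[of "\<Sigma> *v \<eta>"]
        by (simp only: risk meas step_down_measurable mult_le_cancel_left_pos)
    qed
    \<comment> \<open>In natural parameters the \<open>j\<close>-th null hypothesis is the
      hyperplane orthogonal to the \<open>j\<close>-th column.\<close>
    have param: "(\<Sigma> *v \<eta>) $ j = \<eta> \<bullet> column j \<Sigma>" for \<eta>
      using positive_definite_inner_commute[OF A, of \<eta> "axis j 1"]
      by (simp add: column_eq_mult_axis inner_axis)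
    have "AE x in lborel. \<Phi>' j x = ?\<Phi> j x"
    proof (rule convex_sections_test_unique[where w = ?w and g = "column j \<Sigma>"])
      show "AE x in lborel. convex {r. ?\<Phi> j (x + r *\<^sub>R column j \<Sigma>) = 0}"
        using AE_untied[of j] by eventually_elim (rule convex_acceptance_section)
      have "\<Sigma> *v axis j 1 \<noteq> 0"
        using A unfolding positive_definite_def by (metis axis_eq_0_iff inner_zero_right less_irrefl zero_neq_one)
      thus "column j \<Sigma> \<noteq> 0" by (simp add: column_eq_mult_axis)
      show "?\<Phi> j x = 0 \<or> ?\<Phi> j x = 1" for x by (simp add: step_down_def)
      fix \<eta>
      show "(\<integral>x. \<Phi>' j x * (?w x * exp (\<eta> \<bullet> x)) \<partial>lborel) \<le> (\<integral>x. ?\<Phi> j x * (?w x * exp (\<eta> \<bullet> x)) \<partial>lborel)"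
        if "\<eta> \<bullet> column j \<Sigma> = 0"
        using le'[of \<eta>] that by (simp add: loss_def param)
      \<comment> \<open>Off the hyperplane the loss is one minus the test; cancelling the integral
        of the weight reverses the inequality.\<close>
      show "(\<integral>x. ?\<Phi> j x * (?w x * exp (\<eta> \<bullet> x)) \<partial>lborel) \<le> (\<integral>x. \<Phi>' j x * (?w x * exp (\<eta> \<bullet> x)) \<partial>lborel)"
        if "\<eta> \<bullet> column j \<Sigma> \<noteq> 0"
        using le'[of \<eta>] that wint[of \<eta>] int[OF meas bnd] int[OF step_down_measurable \<Phi>01]
        by (simp add: loss_def param left_diff_distrib)
    qed (use bnd wint in auto)
    hence "(\<integral>x. loss j (\<Phi>' j x) \<theta> * (?w x * exp ((?P *v \<theta>) \<bullet> x)) \<partial>lborel) =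
        (\<integral>x. loss j (?\<Phi> j x) \<theta> * (?w x * exp ((?P *v \<theta>) \<bullet> x)) \<partial>lborel)"
      by (intro integral_cong_AE) (auto simp: loss_def elim: eventually_mono)
    thus ?thesis by (simp only: risk meas step_down_measurable)
  qed
  thus ?thesis unfolding admissible_def inadmissible_def using test by (metis less_irrefl)
qed

end
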